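(* Let $\mathcal{G}=(\mathcal{V},\mathcal{E},\mathcal{L})$ be a deterministic, primitive labelled graph with binary edge labels (label length $s=1$) presenting the constrained system $\mathcal{S}$. With $\mathrm{Cap}(\mathcal{S})$, $R_{\rm GV}$, $\Lambda(y;\mathbf{B})$, $\delta(y)$ and $\delta_{\max}$ as defined in the context, define for $y\in[0,1]$ $$\rho_{\rm GV}(y)\triangleq 2\,\mathrm{Cap}(\mathcal{S})+\delta(y)\log y-\log\Lambda(y;\mathbf{B}).$$ Then the GV curve $\mathcal{GV}(\mathcal{S})\triangleq\{(\delta,R_{\rm GV}(\delta)):\delta\in[0,1]\}$ is given by $$\mathcal{GV}(\mathcal{S})=\{(\delta(y),\rho_{\rm GV}(y)):y\in[0,1]\}\cup\{(\delta,0):\delta\ge\delta_{\max}\}.$$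
   Context: $\Sigma=\{0,1\}$. $\mathcal{G}=(\mathcal{V},\mathcal{E},\mathcal{L})$ is a finite directed graph (parallel edges allowed) with edge labelling $\mathcal{L}:\mathcal{E}\to\Sigma$; it is deterministic (outgoing edges of each state carry distinct labels) and primitive. $\mathcal{S}$ is the set of words obtained by reading labels along paths of $\mathcal{G}$, and $\mathcal{S}_n$ the set of its words of length $n$. $\log$ is to a fixed base (base 2). $\mathrm{Cap}(\mathcal{S})=\limsup_{n\to\infty}\frac1n\log|\mathcal{S}_n|$. For $\mathbf{x}\in\mathcal{S}_n$ let $V(\mathbf{x},r)=|\{\mathbf{y}\in\mathcal{S}_n:d_H(\mathbf{x},\mathbf{y})\le r\}|$ ($d_H$ = Hamming distance), $T(n,d)=\sum_{\mathbf{x}\in\mathcal{S}_n}V(\mathbf{x},d-1)$, $\widetilde T(\delta)=\limsup_{n\to\infty}\frac1n\log T(n,\lfloor\delta n\rfloor)$, and $R_{\rm GV}(\delta)=2\,\mathrm{Cap}(\mathcal{S})-\widetilde T(\delta)$. Distance matrix: $\mathbf{T}(y)$ is indexed by $\mathcal{V}\times\mathcal{V}$, with $((u,u'),(v,v'))$-entry $\sum y^{d_H(\mathcal{L}(e),\mathcal{L}(e'))}$, the sum over pairs of edges $e:u\to v$, $e':u'\to v'$ (zero if there are none). Fix an ordering $v_1,\dots,v_M$ of $\mathcal{V}$ and let $\mathcal{V}^{(2)}=\{(v_i,v_j):1\le i\le j\le M\}$. The reduced distance matrix $\mathbf{B}_{\mathcal{G}\times\mathcal{G}}(y)$ is indexed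 by $\mathcal{V}^{(2)}$, with $((v_i,v_j),(v_k,v_\ell))$-entry equal to $\mathbf{T}(y)_{(v_i,v_j),(v_k,v_\ell)}+\mathbf{T}(y)_{(v_i,v_j),(v_\ell,v_k)}$ if $k<\ell$ and $\mathbf{T}(y)_{(v_i,v_j),(v_k,v_k)}$ if $k=\ell$. $\Lambda(y;\mathbf{B})$ denotes the dominant (largest) eigenvalue of $\mathbf{B}_{\mathcal{G}\times\mathcal{G}}(y)$, and $\Lambda'(y;\mathbf{B})$ its derivative in $y$. $\delta(y)\triangleq y\Lambda'(y;\mathbf{B})/\Lambda(y;\mathbf{B})$ and $\delta_{\max}\triangleq\delta(1)=\Lambda'(1;\mathbf{B})/\Lambda(1;\mathbf{B})$. At $y=0$ the term $\delta(0)\log 0$ is interpreted as $0$.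
   Formalization: The segment {(δ,0): δ ≥ δ_max} is restricted to δ ≤ 1, since the GV curve only has δ in [0,1]; T(n,0) is taken with radius 0 instead of −1, so that R_GV(0) is finite; δ(0) is 0 and Λ' at y=0 is one-sided. *)

theory Defs
  imports Complex_Main "HOL-Library.Extended_Real" "HOL-Library.Liminf_Limsup"
begin

text \<open>A labelled graph is given by a finite edge type 'e, a finite vertex type 'v,
  source/target maps and a binary labelling (bool plays the role of {0,1}).
  Parallel edges are allowed since edges are a separate type.\<close>

definition deterministic :: "('e \<Rightarrow> 'v) \<Rightarrow> ('e \<Rightarrow> bool) \<Rightarrow> bool" where
  "deterministic src lab \<longleftrightarrow> (\<forall>e e'. src e = src e' \<and> lab e = lab e' \<longrightarrow> e = e')"

definition is_path :: "('e \<Rightarrow> 'v) \<Rightarrow> ('e \<Rightarrow> 'v) \<Rightarrow> 'e list \<Rightarrow> bool" where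
  "is_path src tgt es \<longleftrightarrow> (\<forall>i. Suc i < length es \<longrightarrow> tgt (es ! i) = src (es ! Suc i))"

definition path_from_to :: "('e \<Rightarrow> 'v) \<Rightarrow> ('e \<Rightarrow> 'v) \<Rightarrow> 'v \<Rightarrow> 'v \<Rightarrow> 'e list \<Rightarrow> bool" where
  "path_from_to src tgt u v es \<longleftrightarrow> es \<noteq> [] \<and> is_path src tgt es \<and>
      src (hd es) = u \<and> tgt (last es) = v"

text \<open>Primitive: some power of the adjacency matrix is entrywise positive.\<close>
definition primitive :: "('e \<Rightarrow> 'v) \<Rightarrow> ('e \<Rightarrow> 'v) \<Rightarrow> bool" where
  "primitive src tgt \<longleftrightarrow> (\<exists>m>0. \<forall>u v. \<exists>es. length es = m \<and> path_from_to src tgt u v es)"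

definition words :: "('e \<Rightarrow> 'v) \<Rightarrow> ('e \<Rightarrow> 'v) \<Rightarrow> ('e \<Rightarrow> bool) \<Rightarrow> nat \<Rightarrow> bool list set" where
  "words src tgt lab n = {map lab es | es. is_path src tgt es \<and> length es = n}"

definition hamming :: "bool list \<Rightarrow> bool list \<Rightarrow> nat" where
  "hamming x y = card {i. i < length x \<and> x ! i \<noteq> y ! i}"

definition capacity :: "('e \<Rightarrow> 'v) \<Rightarrow> ('e \<Rightarrow> 'v) \<Rightarrow> ('e \<Rightarrow> bool) \<Rightarrow> real" where
  "capacity src tgt lab =
     real_of_ereal (limsup (\<lambda>n. ereal (log 2 (real (card (words src tgt lab n))) / real n)))"

definition ball_vol :: "('e \<Rightarrow> 'v) \<Rightarrow> ('e \<Rightarrow> 'v) \<Rightarrow> ('e \<Rightarrow> bool) \<Rightarrow> nat \<Rightarrow> bool list \<Rightarrow> nat \<Rightarrow> nat" where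
  "ball_vol src tgt lab n x r = card {y \<in> words src tgt lab n. hamming x y \<le> r}"

text \<open>T(n,d) = sum of V(x,d-1); natural-number subtraction: d - 1 = 0 for d = 0.\<close>
definition T_total :: "('e \<Rightarrow> 'v) \<Rightarrow> ('e \<Rightarrow> 'v) \<Rightarrow> ('e \<Rightarrow> bool) \<Rightarrow> nat \<Rightarrow> nat \<Rightarrow> nat" where
  "T_total src tgt lab n d = (\<Sum>x \<in> words src tgt lab n. ball_vol src tgt lab n x (d - 1))"

definition T_tilde :: "('e \<Rightarrow> 'v) \<Rightarrow> ('e \<Rightarrow> 'v) \<Rightarrow> ('e \<Rightarrow> bool) \<Rightarrow> real \<Rightarrow> real" where
  "T_tilde src tgt lab \<delta> =
     real_of_ereal (limsup (\<lambda>n. ereal (log 2 (real (T_total src tgt lab n (nat \<lfloor>\<delta> * real n\<rfloor>))) / real n)))"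

definition R_GV :: "('e \<Rightarrow> 'v) \<Rightarrow> ('e \<Rightarrow> 'v) \<Rightarrow> ('e \<Rightarrow> bool) \<Rightarrow> real \<Rightarrow> real" where
  "R_GV src tgt lab \<delta> = 2 * capacity src tgt lab - T_tilde src tgt lab \<delta>"

text \<open>Distance matrix T(y), indexed by pairs of vertices.  Labels have length 1,
  so the Hamming distance of two labels is 0 or 1.\<close>
definition dist_matrix :: "('e::finite \<Rightarrow> 'v) \<Rightarrow> ('e \<Rightarrow> 'v) \<Rightarrow> ('e \<Rightarrow> bool) \<Rightarrow> real \<Rightarrow> ('v \<times> 'v) \<Rightarrow> ('v \<times> 'v) \<Rightarrow> real" where
  "dist_matrix src tgt lab y p q =
     (\<Sum>e \<in> {e. src e = fst p \<and> tgt e = fst q}. \<Sum>e' \<in> {e'. src e' = snd p \<and> tgt e' = snd q}.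
        y ^ (if lab e = lab e' then 0 else 1))"

definition pairs2 :: "('v::linorder \<times> 'v) set" where
  "pairs2 = {(u, v). u \<le> v}"

definition red_matrix :: "('e::finite \<Rightarrow> 'v::linorder) \<Rightarrow> ('e \<Rightarrow> 'v) \<Rightarrow> ('e \<Rightarrow> bool) \<Rightarrow> real \<Rightarrow> ('v \<times> 'v) \<Rightarrow> ('v \<times> 'v) \<Rightarrow> real" where
  "red_matrix src tgt lab y p q =
     (if fst q < snd q then dist_matrix src tgt lab y p q + dist_matrix src tgt lab y p (snd q, fst q)
      else dist_matrix src tgt lab y p q)"

definition is_eigenvalue_on :: "'i set \<Rightarrow> ('i \<Rightarrow> 'i \<Rightarrow> real) \<Rightarrow> real \<Rightarrow> bool" where
  "is_eigenvalue_on I A c \<longleftrightarrow>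
     (\<exists>x. (\<exists>p\<in>I. x p \<noteq> 0) \<and> (\<forall>p\<in>I. (\<Sum>q\<in>I. A p q * x q) = c * x p))"

definition Lambda :: "('e::finite \<Rightarrow> 'v::{finite,linorder}) \<Rightarrow> ('e \<Rightarrow> 'v) \<Rightarrow> ('e \<Rightarrow> bool) \<Rightarrow> real \<Rightarrow> real" where
  "Lambda src tgt lab y = Max {c. is_eigenvalue_on pairs2 (red_matrix src tgt lab y) c}"

text \<open>Derivative of the dominant eigenvalue (taken within y \<ge> 0, so one-sided at y = 0).\<close>
definition Lambda' :: "('e::finite \<Rightarrow> 'v::{finite,linorder}) \<Rightarrow> ('e \<Rightarrow> 'v) \<Rightarrow> ('e \<Rightarrow> bool) \<Rightarrow> real \<Rightarrow> real" where
  "Lambda' src tgt lab y = (SOME D. (Lambda src tgt lab has_real_derivative D) (at y within {0..}))"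

definition delta_y :: "('e::finite \<Rightarrow> 'v::{finite,linorder}) \<Rightarrow> ('e \<Rightarrow> 'v) \<Rightarrow> ('e \<Rightarrow> bool) \<Rightarrow> real \<Rightarrow> real" where
  "delta_y src tgt lab y = y * Lambda' src tgt lab y / Lambda src tgt lab y"

definition delta_max :: "('e::finite \<Rightarrow> 'v::{finite,linorder}) \<Rightarrow> ('e \<Rightarrow> 'v) \<Rightarrow> ('e \<Rightarrow> bool) \<Rightarrow> real" where
  "delta_max src tgt lab = Lambda' src tgt lab 1 / Lambda src tgt lab 1"

text \<open>rho_GV(y); the term delta(0) log 0 is interpreted as 0.\<close>
definition rho_GV :: "('e::finite \<Rightarrow> 'v::{finite,linorder}) \<Rightarrow> ('e \<Rightarrow> 'v) \<Rightarrow> ('e \<Rightarrow> bool) \<Rightarrow> real \<Rightarrow> real" where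
  "rho_GV src tgt lab y = 2 * capacity src tgt lab
     + (if y = 0 then 0 else delta_y src tgt lab y * log 2 y)
     - log 2 (Lambda src tgt lab y)"

definition GV_curve :: "('e \<Rightarrow> 'v) \<Rightarrow> ('e \<Rightarrow> 'v) \<Rightarrow> ('e \<Rightarrow> bool) \<Rightarrow> (real \<times> real) set" where
  "GV_curve src tgt lab = {(\<delta>, R_GV src tgt lab \<delta>) | \<delta>. \<delta> \<in> {0..1}}"

end

theory Submission
  imports Defs "HOL-Analysis.Analysis"
begin

text \<open>
  Write \<open>N n y\<close> for the sum of \<open>y ^ d\<^sub>H(w, w')\<close> over all pairs of words of length \<open>n\<close>. Since the graph
  is deterministic, \<open>N n y\<close> agrees up to a constant factor with the sum of the entries of the
  \<open>n\<close>-th power of the distance matrix, so \<open>ln (N n y) / n\<close> tends to \<open>ln \<Lambda>(y)\<close>. For \<open>y > 0\<close>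
  the distance matrix is primitive. Its normalised Perron vector is unique and hence (closed graph,
  compact simplex) continuous in \<open>y\<close>, and it is symmetric under swapping coordinates, so \<open>\<Lambda>(y)\<close> is
  also the dominant eigenvalue of the reduced matrix; pairing with the left Perron vector shows that
  \<open>\<Lambda>\<close> is continuously differentiable.

  Put \<open>F t = ln \<Lambda>(e\<^sup>t)\<close>, so that \<open>F' t = \<delta>(e\<^sup>t)\<close>. Differentiability makes the weights
  \<open>exp (t d\<^sub>H)\<close> concentrate on pairs at distance about \<open>F' t * n\<close> (the Gaertner--Ellis argument). This gives
  convexity of \<open>F\<close>, and together with the Chernoff bound it shows that the number of pairs at
  distance below \<open>F' t * n\<close> grows like \<open>exp (n (F t - t F' t))\<close> for \<open>t \<le> 0\<close>. The matrix at \<open>y = 0\<close> may be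
  reducible; there \<open>\<Lambda>(0) = sqrt \<Lambda>(1)\<close> because \<open>N n 0\<close> and \<open>N n 1\<close> are \<open>|S\<^sub>n|\<close> and \<open>|S\<^sub>n|\<^sup>2\<close>, and a
  limit of Perron vectors is an eigenvector for it.
\<close>

section \<open>Perron theory of primitive matrices\<close>

primrec matpow :: "real^'n^'n \<Rightarrow> nat \<Rightarrow> real^'n^'n" where
  "matpow A 0 = mat 1"
| "matpow A (Suc k) = A ** matpow A k"

lemma matpow_commute: "A ** matpow A k = matpow A k ** A"
  by (induction k) (auto simp: matrix_mul_assoc)

lemma transpose_matpow: "transpose (matpow A k) = matpow (transpose A) k"
  by (induction k) (auto simp: matrix_transpose_mul matpow_commute[symmetric])

lemma matpow_eigenvector:
  assumes "A *v x = c *\<^sub>R x"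
  shows "matpow A k *v x = c ^ k *\<^sub>R x"
  by (induction k)
     (auto simp: matrix_vector_mul_assoc[symmetric] matrix_vector_mult_scaleR assms)

definition nonneg_mat :: "real^'n^'n \<Rightarrow> bool" where
  "nonneg_mat A \<longleftrightarrow> (\<forall>i j. 0 \<le> A $ i $ j)"

definition primitive_mat :: "real^'n^'n \<Rightarrow> bool" where
  "primitive_mat A \<longleftrightarrow> nonneg_mat A \<and> (\<exists>m>0. \<forall>i j. 0 < matpow A m $ i $ j)"

lemma primitive_mat_transpose: "primitive_mat A \<Longrightarrow> primitive_mat (transpose A)"
  unfolding primitive_mat_def nonneg_mat_def transpose_matpow[symmetric]
  by (auto simp: transpose_def)

abbreviation coord_sum :: "real^'n \<Rightarrow> real" where
  "coord_sum x \<equiv> \<Sum>i\<in>UNIV. x $ i"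

definition std_simplex :: "(real^'n) set" where
  "std_simplex = {x. (\<forall>i. 0 \<le> x $ i) \<and> coord_sum x = 1}"

lemma compact_std_simplex: "compact (std_simplex :: (real^'n) set)"
proof -
  have "closed (std_simplex :: (real^'n) set)"
    unfolding std_simplex_def
    by (intro closed_Collect_conj closed_Collect_all closed_Collect_le closed_Collect_eq
        continuous_intros)
  moreover have "norm x \<le> 1" if "x \<in> std_simplex" for x :: "real^'n"
    using that norm_le_l1_cart[of x] by (auto simp: std_simplex_def)
  then have "bounded (std_simplex :: (real^'n) set)"
    by (auto simp: bounded_iff)
  ultimately show ?thesis by (simp add: compact_eq_bounded_closed)
qed

lemma convex_std_simplex: "convex (std_simplex :: (real^'n) set)"
  unfolding convex_def std_simplex_def
  by (auto simp: sum.distrib sum_distrib_left[symmetric])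

lemma std_simplex_nonempty: "(std_simplex :: (real^'n) set) \<noteq> {}"
proof -
  have "(\<chi> i. 1 / real CARD('n)) \<in> (std_simplex :: (real^'n) set)"
    by (simp add: std_simplex_def)
  then show ?thesis by blast
qed

lemma std_simplex_nonzero: "x \<in> std_simplex \<Longrightarrow> x \<noteq> 0"
  by (auto simp: std_simplex_def)

lemma coord_sum_scaleR: "coord_sum (c *\<^sub>R x) = c * coord_sum x"
  by (simp add: sum_distrib_left)

lemma nonneg_mat_mult:
  assumes "nonneg_mat A" "\<And>i. 0 \<le> x $ i"
  shows "0 \<le> (A *v x) $ i"
  using assms by (auto simp: matrix_vector_mult_def nonneg_mat_def intro!: sum_nonneg)

lemma pos_mat_mult:
  fixes A :: "real^'n^'m"
  assumes "\<And>i j. 0 < A $ i $ j" "\<And>i. 0 \<le> x $ i" "x \<noteq> 0"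
  shows "0 < (A *v x) $ i"
proof -
  obtain k where "x $ k \<noteq> 0" using assms(3) by (auto simp: vec_eq_iff)
  then have "0 < x $ k" using assms(2)[of k] by simp
  then have "0 < A $ i $ k * x $ k" using assms(1) by simp
  also have "\<dots> \<le> (\<Sum>j\<in>UNIV. A $ i $ j * x $ j)"
    by (rule member_le_sum) (simp_all add: assms less_imp_le)
  finally show ?thesis by (simp add: matrix_vector_mult_def)
qed

text \<open>Some power of \<open>A\<close> is entrywise positive and multiplies \<open>x\<close> by
  a power of \<open>c\<close>, so that multiple of \<open>x\<close> has no zero entry. Nonnegativity
  of \<open>A\<close> excludes a negative \<open>c\<close>, positivity of the power excludes
  zero.\<close>

lemma primitive_eigenvector_pos:
  assumes A: "primitive_mat A" and x: "\<And>i. 0 \<le> x $ i" "x \<noteq> 0" and eig: "A *v x = c *\<^sub>R x"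
  shows "0 < x $ i" "0 < c"
proof -
  obtain m where m: "m > 0" "\<And>i j. 0 < matpow A m $ i $ j" and nn: "nonneg_mat A"
    using A by (auto simp: primitive_mat_def)
  have *: "0 < c ^ m * x $ i" for i
    using pos_mat_mult[OF m(2) x, of i] by (simp add: matpow_eigenvector[OF eig])
  show **: "0 < x $ i" for i using *[of i] x(1)[of i] by (cases "x $ i = 0") auto
  have "0 \<le> c * x $ i" using nonneg_mat_mult[OF nn x(1), of i] eig by simp
  then have "0 \<le> c" using **[of i] by (simp add: zero_le_mult_iff)
  moreover have "c \<noteq> 0" using *[of i] m(1) by (auto simp: power_0_left)
  ultimately show "0 < c" by simp
qed

text \<open>On the simplex the eigenvalue can only be the coordinate sum of \<open>A *v x\<close>.
  Eliminating it leaves one equation, jointly continuous in \<open>A\<close> and \<open>x\<close>,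
  whose solution set is therefore closed.\<close>

definition is_perron :: "real^'n^'n \<Rightarrow> real^'n \<Rightarrow> bool" where
  "is_perron A x \<longleftrightarrow> x \<in> std_simplex \<and> A *v x = coord_sum (A *v x) *\<^sub>R x"

definition perron_vec :: "real^'n^'n \<Rightarrow> real^'n" where
  "perron_vec A = (SOME x. is_perron A x)"

definition perron_val :: "real^'n^'n \<Rightarrow> real" where
  "perron_val A = coord_sum (A *v perron_vec A)"

lemma is_perronI:
  assumes "x \<in> std_simplex" "A *v x = c *\<^sub>R x"
  shows "is_perron A x" "coord_sum (A *v x) = c"
proof -
  show "coord_sum (A *v x) = c" using assms coord_sum_scaleR[of c x] by (simp add: std_simplex_def)
  then show "is_perron A x" using assms by (simp add: is_perron_def)
qed

text \<open>Brouwer's theorem for the map that rescales \<open>A *v x\<close> back into the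
  simplex.\<close>

lemma ex_is_perron:
  assumes A: "primitive_mat A"
  shows "\<exists>x. is_perron A x"
proof -
  obtain m where m: "m > 0" "\<And>i j. 0 < matpow A m $ i $ j" and nn: "nonneg_mat A"
    using A by (auto simp: primitive_mat_def)
  have pos: "0 < coord_sum (A *v x)" if x: "x \<in> std_simplex" for x
  proof -
    have nonneg: "0 \<le> (A *v x) $ i" for i
      using x by (intro nonneg_mat_mult nn) (auto simp: std_simplex_def)
    obtain k where k: "m = Suc k" using m(1) by (cases m) auto
    \<comment> \<open>The rescaling needs this: if \<open>A\<close> killed \<open>x\<close>, so
      would its \<open>m\<close>-th power with \<open>A\<close> acting first, but that power is
      entrywise positive.\<close>
    have "A *v x \<noteq> 0"
    proof
      assume "A *v x = 0"
      then have "matpow A m *v x = 0"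
        by (simp add: k matpow_commute matrix_vector_mul_assoc[symmetric])
      moreover have "0 < (matpow A m *v x) $ undefined"
        using x std_simplex_nonzero[OF x] by (intro pos_mat_mult m) (auto simp: std_simplex_def)
      ultimately show False by simp
    qed
    then obtain i where "(A *v x) $ i \<noteq> 0" by (auto simp: vec_eq_iff)
    then have "0 < (A *v x) $ i" using nonneg[of i] by simp
    then show ?thesis using nonneg by (intro sum_pos2[of _ i]) auto
  qed
  define f where "f x = inverse (coord_sum (A *v x)) *\<^sub>R (A *v x)" for x
  have "continuous_on std_simplex f"
    unfolding f_def using pos
    by (intro continuous_intros matrix_vector_mult_linear_continuous_on) (auto simp: less_imp_neq[symmetric])
  moreover have "f ` std_simplex \<subseteq> std_simplex"
  proof
    fix z assume "z \<in> f ` std_simplex"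
    then obtain x where x: "x \<in> std_simplex" "z = f x" by auto
    have "0 \<le> z $ i" for i
      using x pos[OF x(1)] nonneg_mat_mult[OF nn, of x i]
      by (auto simp: f_def std_simplex_def)
    moreover have "coord_sum z = 1"
      unfolding x(2) f_def coord_sum_scaleR using pos[OF x(1)] by simp
    ultimately show "z \<in> std_simplex" by (simp add: std_simplex_def)
  qed
  ultimately obtain x where x: "x \<in> std_simplex" "f x = x"
    using brouwer[OF compact_std_simplex convex_std_simplex std_simplex_nonempty] by blast
  have "A *v x = coord_sum (A *v x) *\<^sub>R f x" using pos[OF x(1)] by (simp add: f_def)
  then show ?thesis using x by (auto simp: is_perron_def)
qed

lemma is_perron_pos:
  assumes "primitive_mat A" "is_perron A x"
  shows "0 < x $ i" "0 < coord_sum (A *v x)"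
  using assms primitive_eigenvector_pos[of A x "coord_sum (A *v x)"] std_simplex_nonzero
  by (auto simp: is_perron_def std_simplex_def)

lemma inner_transpose_mult: "(transpose A *v l) \<bullet> x = l \<bullet> (A *v (x::real^'n))"
  by (metis dot_lmul_matrix vector_transpose_matrix transpose_transpose)

lemma inner_pos:
  fixes l x :: "real^'n"
  assumes "\<And>i. 0 < l $ i" "\<And>i. 0 \<le> x $ i" "x \<noteq> 0"
  shows "0 < l \<bullet> x"
proof -
  obtain k where "x $ k \<noteq> 0" using assms(3) by (auto simp: vec_eq_iff)
  then have "0 < x $ k" using assms(2)[of k] by simp
  then show ?thesis unfolding inner_vec_def
    by (intro sum_pos2[of _ k]) (auto simp: assms less_imp_le)
qed

text \<open>Pairing with a positive left eigenvector gives both vectors the same eigenvalue. A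
  difference touching the boundary of the orthant is then a nonnegative eigenvector with a zero
  coordinate, hence zero.\<close>

lemma is_perron_unique:
  assumes A: "primitive_mat A" and x: "is_perron A x" and y: "is_perron A y"
  shows "x = y"
proof -
  obtain l where l: "is_perron (transpose A) l"
    using ex_is_perron[OF primitive_mat_transpose[OF A]] by blast
  define \<mu> where "\<mu> = coord_sum (transpose A *v l)"
  have lpos: "0 < l $ i" for i
    using is_perron_pos[OF primitive_mat_transpose[OF A] l] by simp
  have leig: "transpose A *v l = \<mu> *\<^sub>R l" using l by (simp add: is_perron_def \<mu>_def)
  have val: "A *v z = \<mu> *\<^sub>R z" if z: "is_perron A z" for z
  proof -
    have e: "A *v z = coord_sum (A *v z) *\<^sub>R z" using z by (simp add: is_perron_def)
    have "0 < l \<bullet> z" using z lpos std_simplex_nonzero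
      by (intro inner_pos) (auto simp: is_perron_def std_simplex_def)
    moreover have "\<mu> * (l \<bullet> z) = coord_sum (A *v z) * (l \<bullet> z)"
      using inner_transpose_mult[of A l z] leig e
      by (metis inner_scaleR_left inner_scaleR_right)
    ultimately show ?thesis using e by simp
  qed
  have ypos: "0 < y $ i" for i using is_perron_pos[OF A y] by simp
  \<comment> \<open>The largest multiple of \<open>y\<close> that can be subtracted from
    \<open>x\<close> without leaving the orthant; a coordinate attaining the minimum becomes
    zero.\<close>
  define t where "t = Min (range (\<lambda>i. x $ i / y $ i))"
  define w where "w = x - t *\<^sub>R y"
  have "t \<in> range (\<lambda>i. x $ i / y $ i)" unfolding t_def by (intro Min_in) auto
  then obtain k where k: "t = x $ k / y $ k" by auto
  have "t \<le> x $ i / y $ i" for i unfolding t_def by (intro Min_le) auto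
  then have w0: "0 \<le> w $ i" for i 
    using ypos[of i] by (simp add: w_def pos_le_divide_eq[symmetric])
  have wk: "w $ k = 0" using ypos[of k] by (simp add: w_def k)
  have "A *v w = \<mu> *\<^sub>R w"
    by (simp add: w_def matrix_vector_mult_diff_distrib matrix_vector_mult_scaleR val x y
        scaleR_diff_right)
  then have "w = 0" using primitive_eigenvector_pos(1)[OF A w0] wk by (metis less_irrefl)
  then have eq: "x = t *\<^sub>R y" by (simp add: w_def)
  then have "coord_sum x = t * coord_sum y" using coord_sum_scaleR by simp
  then have "t = 1" using x y by (auto simp: is_perron_def std_simplex_def)
  then show ?thesis using eq by simp
qed

lemma is_perron_perron_vec: "primitive_mat A \<Longrightarrow> is_perron A (perron_vec A)"
  unfolding perron_vec_def using ex_is_perron by (rule someI_ex)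

lemma perron_vec_eqI: "primitive_mat A \<Longrightarrow> is_perron A x \<Longrightarrow> perron_vec A = x"
  using is_perron_unique is_perron_perron_vec by blast

lemma perron_eigen: "primitive_mat A \<Longrightarrow> A *v perron_vec A = perron_val A *\<^sub>R perron_vec A"
  using is_perron_perron_vec[of A] unfolding is_perron_def perron_val_def by blast

section \<open>Continuity and differentiability of the Perron data\<close>

lemma continuous_on_mat_vec:
  fixes f :: "'a::topological_space \<Rightarrow> real^'n^'m"
  assumes "continuous_on S f" "continuous_on S g"
  shows "continuous_on S (\<lambda>z. f z *v g z)"
  unfolding matrix_vector_mult_def
  by (intro continuous_on_vec_lambda continuous_intros assms)

text \<open>By uniqueness the graph of the Perron vector is the whole zero set of a continuous map,
  hence closed; a closed graph with compact target means continuity.\<close>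

lemma continuous_on_perron_vec:
  fixes A :: "'a::euclidean_space \<Rightarrow> real^'n^'n"
  assumes A: "continuous_on S A" and prim: "\<And>z. z \<in> S \<Longrightarrow> primitive_mat (A z)"
  shows "continuous_on S (\<lambda>z. perron_vec (A z))"
proof -
  have sub: "(\<lambda>z. perron_vec (A z)) \<in> S \<rightarrow> std_simplex"
    using is_perron_perron_vec prim by (auto simp: is_perron_def)
  have graph: "(\<lambda>z. (z, perron_vec (A z))) ` S =
     {p \<in> S \<times> std_simplex. A (fst p) *v snd p - coord_sum (A (fst p) *v snd p) *\<^sub>R snd p = 0}"
    (is "?L = ?R")
  proof
    show "?L \<subseteq> ?R" using is_perron_perron_vec prim by (auto simp: is_perron_def)
    show "?R \<subseteq> ?L"
    proof
      fix p assume p: "p \<in> ?R"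
      then have "is_perron (A (fst p)) (snd p)" by (auto simp: is_perron_def)
      then have "perron_vec (A (fst p)) = snd p" using p
        by (intro perron_vec_eqI prim) auto
      then show "p \<in> ?L" using p by (intro image_eqI[of _ _ "fst p"]) auto
    qed
  qed
  have Ac: "continuous_on (S \<times> std_simplex) (\<lambda>p. A (fst p))"
    by (rule continuous_on_compose2[OF A continuous_on_fst[OF continuous_on_id]]) auto
  have "closedin (top_of_set (S \<times> std_simplex)) ((\<lambda>z. (z, perron_vec (A z))) ` S)"
    unfolding graph
    by (intro continuous_closedin_preimage_constant continuous_intros continuous_on_mat_vec Ac)
  then show ?thesis
    using continuous_closed_graph_eq[OF compact_std_simplex sub] by simp
qed

text \<open>Testing the eigenvalue equation at \<open>z\<close> against the left eigenvector at
  \<open>y\<close> gives the difference quotient exactly, with \<open>x z\<close> in place of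
  \<open>x y\<close>. Only continuity of the Perron vector is then used, never its
  derivative.\<close>

lemma perron_val_has_derivative:
  fixes A0 A1 :: "real^'n^'n"
  defines "A \<equiv> \<lambda>z. A0 + z *\<^sub>R A1"
  assumes S: "open S" "y \<in> S" and prim: "\<And>z. z \<in> S \<Longrightarrow> primitive_mat (A z)"
  defines "l \<equiv> \<lambda>z. perron_vec (transpose (A z))" and "x \<equiv> \<lambda>z. perron_vec (A z)"
  shows "((\<lambda>z. perron_val (A z)) has_real_derivative
           l y \<bullet> (A1 *v x y) / (l y \<bullet> x y)) (at y)"
proof -
  have lx: "0 < l y \<bullet> x z" if "z \<in> S" for z
  proof (rule inner_pos)
    show "0 < l y $ i" for i unfolding l_def
      using S by (intro is_perron_pos[OF _ is_perron_perron_vec] primitive_mat_transpose prim)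
    have "is_perron (A z) (x z)" unfolding x_def by (intro is_perron_perron_vec prim that)
    then show "0 \<le> x z $ i" "x z \<noteq> 0" for i
      using std_simplex_nonzero by (auto simp: is_perron_def std_simplex_def)
  qed
  have left: "transpose (A y) *v l y = perron_val (transpose (A y)) *\<^sub>R l y"
    unfolding l_def using S by (intro perron_eigen primitive_mat_transpose prim)
  have right: "A z *v x z = perron_val (A z) *\<^sub>R x z" if "z \<in> S" for z
    unfolding x_def using that by (intro perron_eigen prim)
  have leftval: "l y \<bullet> (A y *v w) = perron_val (transpose (A y)) * (l y \<bullet> w)" for w
    using inner_transpose_mult[of "A y" "l y" w] left by simp
  have "perron_val (transpose (A y)) = perron_val (A y)"
    using leftval[of "x y"] right[OF S(2)] lx[OF S(2)] by simp
  then have leftval: "l y \<bullet> (A y *v w) = perron_val (A y) * (l y \<bullet> w)" for w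
    using leftval by simp
  have quot: "(perron_val (A z) - perron_val (A y)) / (z - y) =
      l y \<bullet> (A1 *v x z) / (l y \<bullet> x z)" if z: "z \<in> S" "z \<noteq> y" for z
  proof -
    have "perron_val (A z) * (l y \<bullet> x z) = l y \<bullet> (A z *v x z)" using right z by simp
    also have "A z *v x z = A y *v x z + (z - y) *\<^sub>R (A1 *v x z)"
      by (simp add: A_def algebra_simps scaleR_matrix_vector_assoc[symmetric])
    also have "l y \<bullet> \<dots> = perron_val (A y) * (l y \<bullet> x z) + (z - y) * (l y \<bullet> (A1 *v x z))"
      by (simp add: inner_add_right leftval)
    finally have "(perron_val (A z) - perron_val (A y)) * (l y \<bullet> x z) =
        (z - y) * (l y \<bullet> (A1 *v x z))" by (simp add: algebra_simps)
    then show ?thesis using lx[OF z(1)] z(2) by (simp add: field_simps)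
  qed
  have "continuous_on S x"
    unfolding x_def by (intro continuous_on_perron_vec prim) (auto simp: A_def intro!: continuous_intros)
  then have "continuous_on S (\<lambda>z. l y \<bullet> (A1 *v x z) / (l y \<bullet> x z))"
    using lx by (intro continuous_intros continuous_on_mat_vec) (auto simp: less_imp_neq[symmetric])
  then have "isCont (\<lambda>z. l y \<bullet> (A1 *v x z) / (l y \<bullet> x z)) y"
    using S continuous_on_eq_continuous_at by blast
  then have "((\<lambda>z. l y \<bullet> (A1 *v x z) / (l y \<bullet> x z)) \<longlongrightarrow> l y \<bullet> (A1 *v x y) / (l y \<bullet> x y)) (at y)"
    by (simp add: isCont_def)
  then have "((\<lambda>z. (perron_val (A z) - perron_val (A y)) / (z - y)) \<longlongrightarrow>
      l y \<bullet> (A1 *v x y) / (l y \<bullet> x y)) (at y)"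
  proof (rule Lim_transform_eventually)
    have "\<forall>\<^sub>F z in at y. z \<in> S - {y}" using S by (simp add: eventually_at_topological) blast
    then show "\<forall>\<^sub>F z in at y. l y \<bullet> (A1 *v x z) / (l y \<bullet> x z) =
        (perron_val (A z) - perron_val (A y)) / (z - y)"
      by eventually_elim (simp add: quot)
  qed
  then show ?thesis by (simp add: has_field_derivative_iff)
qed

text \<open>Makes the dominant eigenvalue continuously differentiable, so that
  \<open>delta_y\<close> will take all intermediate values.\<close>

lemma continuous_on_perron_val_deriv:
  fixes A0 A1 :: "real^'n^'n"
  defines "A \<equiv> \<lambda>z. A0 + z *\<^sub>R A1"
  assumes prim: "\<And>z. z \<in> S \<Longrightarrow> primitive_mat (A z)"
  defines "l \<equiv> \<lambda>z. perron_vec (transpose (A z))" and "x \<equiv> \<lambda>z. perron_vec (A z)"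
  shows "continuous_on S (\<lambda>z. l z \<bullet> (A1 *v x z) / (l z \<bullet> x z))"
proof -
  have "0 < l z \<bullet> x z" if "z \<in> S" for z
  proof (rule inner_pos)
    show "0 < l z $ i" for i unfolding l_def
      using that by (intro is_perron_pos[OF _ is_perron_perron_vec] primitive_mat_transpose prim)
    have "is_perron (A z) (x z)" unfolding x_def by (intro is_perron_perron_vec prim that)
    then show "0 \<le> x z $ i" "x z \<noteq> 0" for i
      using std_simplex_nonzero by (auto simp: is_perron_def std_simplex_def)
  qed
  moreover have "continuous_on S x"
    unfolding x_def by (intro continuous_on_perron_vec prim) (auto simp: A_def intro!: continuous_intros)
  moreover have "continuous_on S l"
    unfolding l_def
    by (intro continuous_on_perron_vec primitive_mat_transpose prim)
       (auto simp: A_def transpose_def intro!: continuous_intros continuous_on_vec_lambda)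
  ultimately show ?thesis
    by (intro continuous_intros continuous_on_mat_vec) (auto simp: less_imp_neq[symmetric])
qed

section \<open>Growth of matrix powers and its relation to eigenvalues\<close>

lemma matrix_vector_mult_mono:
  assumes "nonneg_mat A" "\<And>i. x $ i \<le> y $ i"
  shows "(A *v x) $ i \<le> (A *v y) $ i"
  using assms by (auto simp: matrix_vector_mult_def nonneg_mat_def intro!: sum_mono mult_left_mono)

lemma nonneg_matpow: "nonneg_mat A \<Longrightarrow> nonneg_mat (matpow A k)"
  by (induction k)
     (auto simp: nonneg_mat_def mat_def matrix_matrix_mult_def intro!: sum_nonneg)

text \<open>The sum of all entries of the power: \<open>1\<close> is the all-ones vector.\<close>

definition row_total :: "real^'n^'n \<Rightarrow> nat \<Rightarrow> real" where
  "row_total A k = coord_sum (matpow A k *v 1)"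

lemma ln_div_tendsto_squeeze:
  fixes f :: "nat \<Rightarrow> real"
  assumes "0 < c" "0 < C" "0 < \<mu>"
    and lo: "\<And>n. c * \<mu> ^ n \<le> f n" and hi: "\<And>n. f n \<le> C * \<mu> ^ n"
  shows "(\<lambda>n. ln (f n) / real n) \<longlonglongrightarrow> ln \<mu>"
proof (rule tendsto_sandwich)
  have pos: "0 < f n" for n by (rule less_le_trans[OF _ lo]) (simp add: assms)
  have *: "(\<lambda>n. ln d / real n + ln \<mu>) \<longlonglongrightarrow> ln \<mu>" for d :: real
    by (rule tendsto_eq_intros lim_const_over_n | simp)+
  show "(\<lambda>n. ln c / real n + ln \<mu>) \<longlonglongrightarrow> ln \<mu>" "(\<lambda>n. ln C / real n + ln \<mu>) \<longlonglongrightarrow> ln \<mu>"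
    by (rule *)+
  have eq: "ln d / real n + ln \<mu> = ln (d * \<mu> ^ n) / real n" if "0 < d" "0 < n" for d n
    using that assms by (simp add: ln_mult ln_realpow field_simps)
  show "\<forall>\<^sub>F n in sequentially. ln c / real n + ln \<mu> \<le> ln (f n) / real n"
    using eventually_gt_at_top[of 0]
  proof eventually_elim
    case (elim n)
    then show ?case using lo[of n] assms pos[of n] by (simp add: eq divide_right_mono)
  qed
  show "\<forall>\<^sub>F n in sequentially. ln (f n) / real n \<le> ln C / real n + ln \<mu>"
    using eventually_gt_at_top[of 0]
  proof eventually_elim
    case (elim n)
    then show ?case using hi[of n] assms pos[of n] by (simp add: eq divide_right_mono)
  qed
qed

text \<open>The all-ones vector lies entrywise between the Perron vector \<open>x\<close> and
  \<open>x\<close> divided by its least entry, and each application of \<open>A\<close> scales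
  \<open>x\<close> by the Perron root.\<close>

lemma row_total_growth:
  fixes A :: "real^'n^'n"
  assumes A: "primitive_mat A"
  shows "(\<lambda>n. ln (row_total A n) / real n) \<longlonglongrightarrow> ln (perron_val A)"
proof -
  define x where "x = perron_vec A"
  have nn: "nonneg_mat A" using A by (simp add: primitive_mat_def)
  have per: "is_perron A x" unfolding x_def by (rule is_perron_perron_vec[OF A])
  have xpos: "0 < x $ i" for i using is_perron_pos[OF A per] by simp
  have xsum: "coord_sum x = 1" using per by (simp add: is_perron_def std_simplex_def)
  have lam: "0 < perron_val A" using is_perron_pos[OF A per] by (simp add: perron_val_def x_def)
  have eig: "matpow A n *v x = perron_val A ^ n *\<^sub>R x" for n
    unfolding x_def by (rule matpow_eigenvector[OF perron_eigen[OF A]])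
  have tot: "coord_sum (matpow A n *v x) = perron_val A ^ n" for n
    unfolding eig coord_sum_scaleR xsum by simp
  define c where "c = Min (range (\<lambda>i. x $ i))"
  have cpos: "0 < c" unfolding c_def using xpos by (subst Min_gr_iff) auto
  have cle: "c \<le> x $ i" for i unfolding c_def by (intro Min_le) auto
  have le1: "x $ i \<le> 1" for i
    using member_le_sum[of i UNIV "\<lambda>i. x $ i"] xpos xsum by (auto intro: less_imp_le)
  show ?thesis
  proof (rule ln_div_tendsto_squeeze[of 1 "1 / c"])
    fix n
    have "coord_sum (matpow A n *v x) \<le> row_total A n"
      unfolding row_total_def
      by (intro sum_mono matrix_vector_mult_mono nonneg_matpow nn) (simp add: le1)
    then show "1 * perron_val A ^ n \<le> row_total A n" by (simp add: tot)
    have "row_total A n \<le> coord_sum (matpow A n *v ((1 / c) *\<^sub>R x))"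
      unfolding row_total_def using cpos cle
      by (intro sum_mono matrix_vector_mult_mono nonneg_matpow nn) (simp add: field_simps)
    also have "\<dots> = 1 / c * coord_sum (matpow A n *v x)"
      unfolding matrix_vector_mult_scaleR coord_sum_scaleR ..
    finally show "row_total A n \<le> 1 / c * perron_val A ^ n" by (simp add: tot)
  qed (use cpos lam in auto)
qed

text \<open>Iterating on an eigenvector, each coordinate is bounded by the norm of \<open>x\<close>
  times the total of the power. The matrix is only assumed nonnegative, so as to cover the possibly
  reducible distance matrix at \<open>y = 0\<close>.\<close>

lemma eigenvalue_le_growth:
  fixes A :: "real^'n^'n"
  assumes nn: "nonneg_mat A" and eig: "A *v x = c *\<^sub>R x" and "x \<noteq> 0"
    and growth: "(\<lambda>n. ln (row_total A n) / real n) \<longlonglongrightarrow> g"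
  shows "c \<le> exp g"
proof (cases "c \<le> 0")
  case True
  then show ?thesis by (rule order_trans) simp
next
  case False
  obtain k where k: "x $ k \<noteq> 0" using \<open>x \<noteq> 0\<close> by (auto simp: vec_eq_iff)
  define C where "C = norm x"
  have C: "0 < C" using \<open>x \<noteq> 0\<close> by (simp add: C_def)
  have bound: "c ^ n * \<bar>x $ k\<bar> \<le> C * row_total A n" for n
  proof -
    have nnp: "0 \<le> (matpow A n *v 1) $ i" for i
      by (intro nonneg_mat_mult nonneg_matpow nn) simp
    have up: "(matpow A n *v v) $ k \<le> C * row_total A n" if "\<And>i. v $ i \<le> C" for v
    proof -
      have "(matpow A n *v v) $ k \<le> (matpow A n *v (C *\<^sub>R 1)) $ k"
        using that by (intro matrix_vector_mult_mono nonneg_matpow nn) simp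
      also have "\<dots> = C * (matpow A n *v 1) $ k" by (simp add: matrix_vector_mult_scaleR)
      also have "\<dots> \<le> C * row_total A n" unfolding row_total_def
        using C nnp by (intro mult_left_mono member_le_sum) auto
      finally show ?thesis .
    qed
    have xC: "\<bar>x $ i\<bar> \<le> C" for i by (simp add: C_def component_le_norm_cart)
    have "c ^ n * x $ k \<le> C * row_total A n"
      using up[of x] xC by (simp add: matpow_eigenvector[OF eig] abs_le_iff)
    \<comment> \<open>The same bound for the negated eigenvector supplies the absolute
      value.\<close>
    moreover have "A *v (- x) = c *\<^sub>R (- x)" using eig by (simp add: linear_neg[OF matrix_vector_mul_linear])
    then have "c ^ n * (- x $ k) \<le> C * row_total A n"
      using up[of "- x"] xC by (simp add: matpow_eigenvector[of A "- x" c] abs_le_iff minus_le_iff)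
    ultimately show ?thesis by (simp add: abs_if)
  qed
  have "ln c \<le> g"
  proof (rule tendsto_le[OF sequentially_bot])
    show "(\<lambda>n. ln C / real n + ln (row_total A n) / real n) \<longlonglongrightarrow> g"
      by (rule tendsto_eq_intros growth lim_const_over_n | simp)+
    show "(\<lambda>n. ln c + ln \<bar>x $ k\<bar> / real n) \<longlonglongrightarrow> ln c"
      by (rule tendsto_eq_intros lim_const_over_n | simp)+
    show "\<forall>\<^sub>F n in sequentially.
        ln c + ln \<bar>x $ k\<bar> / real n \<le> ln C / real n + ln (row_total A n) / real n"
      using eventually_gt_at_top[of 0]
    proof eventually_elim
      case (elim n)
      have p: "0 < c ^ n * \<bar>x $ k\<bar>" using False k by simp
      then have "0 < C * row_total A n" using bound[of n] by linarith
      then have r: "0 < row_total A n" using C by (simp add: zero_less_mult_iff)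
      have "ln (c ^ n * \<bar>x $ k\<bar>) \<le> ln (C * row_total A n)" using bound[of n] p by simp
      then have "n * ln c + ln \<bar>x $ k\<bar> \<le> ln C + ln (row_total A n)"
        using False k C r by (simp add: ln_mult ln_realpow)
      then have "(n * ln c + ln \<bar>x $ k\<bar>) / real n \<le> (ln C + ln (row_total A n)) / real n"
        by (rule divide_right_mono) simp
      then show ?case using elim by (simp add: add_divide_distrib)
    qed
  qed
  then show ?thesis using False by (metis exp_le_cancel_iff exp_ln not_le)
qed

section \<open>Finiteness of the real spectrum\<close>

lemma eigenvectors_linear_independent:
  fixes A :: "real^'n^'n"
  assumes "finite C" "\<And>c. c \<in> C \<Longrightarrow> A *v v c = c *\<^sub>R v c" "\<And>c. c \<in> C \<Longrightarrow> v c \<noteq> 0"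
    and "(\<Sum>c\<in>C. a c *\<^sub>R v c) = 0"
  shows "\<forall>c\<in>C. a c = 0"
  using assms
proof (induction C arbitrary: a rule: finite_induct)
  case (insert d C)
  have e: "a d *\<^sub>R v d + (\<Sum>c\<in>C. a c *\<^sub>R v c) = 0" using insert by simp
  have lin: "A *v (\<Sum>c\<in>C. a c *\<^sub>R v c) = (\<Sum>c\<in>C. (a c * c) *\<^sub>R v c)"
    using insert.prems(1)
    by (simp add: linear_sum[OF matrix_vector_mul_linear] matrix_vector_mult_scaleR)
  \<comment> \<open>Subtracting \<open>d\<close> times the relation from its image under
    \<open>A\<close> removes \<open>v d\<close> and leaves the coefficients
    \<open>a c * (c - d)\<close>.\<close>
  have "0 = A *v (a d *\<^sub>R v d + (\<Sum>c\<in>C. a c *\<^sub>R v c)) - d *\<^sub>R (a d *\<^sub>R v d + (\<Sum>c\<in>C. a c *\<^sub>R v c))"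
    unfolding e by simp
  also have "\<dots> = (\<Sum>c\<in>C. (a c * (c - d)) *\<^sub>R v c)"
    using insert.prems(1)
    by (simp add: matrix_vector_right_distrib lin matrix_vector_mult_scaleR scaleR_add_right
        scaleR_sum_right sum_subtractf[symmetric] algebra_simps)
  finally have "\<forall>c\<in>C. a c * (c - d) = 0"
    using insert.prems by (intro insert.IH) auto
  then have "\<forall>c\<in>C. a c = 0" using insert.hyps by auto
  then show ?case using e insert.prems(2)[of d] by simp
qed simp

text \<open>\<open>Lambda\<close> is a \<open>Max\<close>, which needs a finite set. Eigenvectors of
  distinct eigenvalues are independent, so there are finitely many.\<close>

lemma finite_eigenvalues:
  fixes A :: "real^'n^'n"
  shows "finite {c. \<exists>x. x \<noteq> 0 \<and> A *v x = c *\<^sub>R x}"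
proof -
  let ?E = "{c. \<exists>x. x \<noteq> 0 \<and> A *v x = c *\<^sub>R x}"
  define v where "v c = (SOME x. x \<noteq> 0 \<and> A *v x = c *\<^sub>R x)" for c
  have v: "v c \<noteq> 0" "A *v v c = c *\<^sub>R v c" if "c \<in> ?E" for c
    using someI_ex[of "\<lambda>x. x \<noteq> 0 \<and> A *v x = c *\<^sub>R x"] that by (auto simp: v_def)
  have inj: "inj_on v ?E"
  proof (rule inj_onI)
    fix c d assume cd: "c \<in> ?E" "d \<in> ?E" "v c = v d"
    then have "c *\<^sub>R v c = d *\<^sub>R v c" using v(2)[OF cd(1)] v(2)[OF cd(2)] by auto
    then show "c = d" using v(1)[OF cd(1)] by simp
  qed
  have "independent (v ` ?E)"
    unfolding independent_explicit_finite_subsets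
  proof (intro allI impI)
    fix B u assume B: "B \<subseteq> v ` ?E" "finite B" "(\<Sum>w\<in>B. u w *\<^sub>R w) = 0"
    obtain C where C: "C \<subseteq> ?E" "finite C" "B = v ` C"
      using finite_subset_image[OF B(2,1)] by blast
    have injC: "inj_on v C" using inj C(1) by (rule inj_on_subset)
    have "\<forall>c\<in>C. u (v c) = 0"
    proof (rule eigenvectors_linear_independent[of C A v])
      show "(\<Sum>c\<in>C. u (v c) *\<^sub>R v c) = 0" using B(3) injC by (simp add: C(3) sum.reindex)
    qed (use C v in auto)
    then show "\<forall>w\<in>B. u w = 0" using C(3) by auto
  qed
  then have "finite (v ` ?E)" by (rule independent_imp_finite)
  then show ?thesis using inj by (rule finite_imageD)
qed

section \<open>Exponential growth of truncated partition sums\<close>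

text \<open>The sums are moment generating functions of \<open>h\<close> under counting measure on
  \<open>P n\<close>; the last two assumptions are those of the Gaertner--Ellis theorem, existence
  and differentiability of the limiting rate.\<close>

locale partition_growth =
  fixes P :: "nat \<Rightarrow> 'p set" and h :: "'p \<Rightarrow> nat" and F a :: "real \<Rightarrow> real"
  assumes fin: "finite (P n)" and nonempty: "P n \<noteq> {}"
    and growth: "(\<lambda>n. ln (\<Sum>p\<in>P n. exp (t * real (h p))) / real n) \<longlonglongrightarrow> F t"
    and deriv: "(F has_real_derivative a t) (at t)"
begin

definition Z :: "nat \<Rightarrow> real \<Rightarrow> real" where
  "Z n t = (\<Sum>p\<in>P n. exp (t * real (h p)))"

lemma Z_pos: "0 < Z n t"
  unfolding Z_def using fin nonempty by (intro sum_pos) auto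

lemma Z_growth: "(\<lambda>n. ln (Z n t) / real n) \<longlonglongrightarrow> F t"
  using growth by (simp add: Z_def)

text \<open>Exponential Markov inequality. The tilt \<eta> may have either sign, so upper and lower
  tails are both covered.\<close>

lemma tail_bound:
  "(\<Sum>p\<in>{p \<in> P n. b \<le> \<eta> * real (h p)}. exp (t * real (h p))) \<le> exp (- b) * Z n (t + \<eta>)"
proof -
  have "(\<Sum>p\<in>{p \<in> P n. b \<le> \<eta> * real (h p)}. exp (t * real (h p)))
      \<le> (\<Sum>p\<in>{p \<in> P n. b \<le> \<eta> * real (h p)}. exp (- b) * exp ((t + \<eta>) * real (h p)))"
    by (intro sum_mono) (auto simp: exp_add[symmetric] algebra_simps)
  also have "\<dots> \<le> (\<Sum>p\<in>P n. exp (- b) * exp ((t + \<eta>) * real (h p)))"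
    using fin by (intro sum_mono2) auto
  finally show ?thesis by (simp add: Z_def sum_distrib_left)
qed

text \<open>Tilting by a further \<open>\<sigma> * \<eta>\<close> costs \<open>F (t + \<sigma> * \<eta>) - F t\<close>, which to first order in \<open>\<eta>\<close> is
  compensated by the centring at \<open>a t * n\<close>; the sign \<open>\<sigma>\<close> selects the tail.\<close>

lemma tail_negligible:
  assumes "\<sigma> = 1 \<or> \<sigma> = -1" and "0 < \<epsilon>"
  shows "\<forall>\<^sub>F n in sequentially.
    (\<Sum>p\<in>{p \<in> P n. \<epsilon> * real n \<le> \<sigma> * (real (h p) - a t * real n)}. exp (t * real (h p))) \<le> Z n t / 4"
proof -
  \<comment> \<open>For a small enough step the error of the linear approximation is below
    \<epsilon> times the step.\<close>
  have "\<exists>\<eta>>0. F (t + \<sigma> * \<eta>) - F t - a t * (\<sigma> * \<eta>) < \<epsilon> * \<eta>"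
  proof -
    have "((\<lambda>s. (F (t + s) - F t) / s) \<longlongrightarrow> a t) (at 0)"
      using deriv[of t] by (simp add: DERIV_def)
    then obtain d where d: "0 < d"
      "\<And>s. s \<noteq> 0 \<and> norm (s - 0) < d \<longrightarrow> norm ((F (t + s) - F t) / s - a t) < \<epsilon>"
      using LIM_D[OF _ \<open>0 < \<epsilon>\<close>] by blast
    define s where "s = \<sigma> * (d / 2)"
    have s: "s \<noteq> 0" "\<bar>s\<bar> < d" "\<bar>s\<bar> = d / 2" using assms(1) d(1) by (auto simp: s_def)
    have "F (t + s) - F t - a t * s = ((F (t + s) - F t) / s - a t) * s"
      using s(1) by (simp add: field_simps)
    also have "\<dots> \<le> \<bar>(F (t + s) - F t) / s - a t\<bar> * \<bar>s\<bar>" by (metis abs_ge_self abs_mult)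
    also have "\<dots> < \<epsilon> * (d / 2)" unfolding s(3)
      using d(1) d(2)[of s] s(1,2) by (intro mult_strict_right_mono) auto
    finally show ?thesis using d(1) by (intro exI[of _ "d / 2"]) (simp add: s_def)
  qed
  then obtain \<eta> where \<eta>: "0 < \<eta>" "F (t + \<sigma> * \<eta>) - F t - a t * (\<sigma> * \<eta>) < \<epsilon> * \<eta>" by blast
  define \<kappa> where "\<kappa> = \<epsilon> * \<eta> - (F (t + \<sigma> * \<eta>) - F t - a t * (\<sigma> * \<eta>))"
  have \<kappa>: "0 < \<kappa>" using \<eta> by (simp add: \<kappa>_def)
  have "(\<lambda>n. ln (Z n (t + \<sigma> * \<eta>)) / real n - ln (Z n t) / real n - (a t * \<sigma> * \<eta> + \<epsilon> * \<eta>))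
      \<longlonglongrightarrow> F (t + \<sigma> * \<eta>) - F t - (a t * \<sigma> * \<eta> + \<epsilon> * \<eta>)"
    by (intro tendsto_intros Z_growth)
  moreover have "F (t + \<sigma> * \<eta>) - F t - (a t * \<sigma> * \<eta> + \<epsilon> * \<eta>) < - (\<kappa> / 2)"
  proof -
    have "F (t + \<sigma> * \<eta>) - F t - (a t * \<sigma> * \<eta> + \<epsilon> * \<eta>) = - \<kappa>"
      by (simp add: \<kappa>_def algebra_simps)
    then show ?thesis using \<kappa> by simp
  qed
  ultimately have "\<forall>\<^sub>F n in sequentially.
      ln (Z n (t + \<sigma> * \<eta>)) / real n - ln (Z n t) / real n - (a t * \<sigma> * \<eta> + \<epsilon> * \<eta>) < - (\<kappa> / 2)"
    by (rule order_tendstoD(2))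
  \<comment> \<open>For such \<open>n\<close> the decay factor with rate \<kappa> / 2 is below 1/4,
    so that removing both tails still leaves half of \<open>Z n t\<close>.\<close>
  moreover have "\<forall>\<^sub>F n in sequentially. ln 4 / (\<kappa> / 2) < real n"
    using filterlim_real_sequentially by (simp add: filterlim_at_top_dense)
  ultimately show ?thesis using eventually_gt_at_top[of 0]
  proof eventually_elim
    case (elim n)
    define b where "b = \<eta> * (\<epsilon> * real n + \<sigma> * a t * real n)"
    have "ln (Z n (t + \<sigma> * \<eta>)) - ln (Z n t) - b < - (\<kappa> / 2) * real n"
      using elim(1,3) by (simp add: b_def field_simps)
    also have "\<dots> < - ln 4" using elim(2) \<kappa> by (simp add: field_simps)
    finally have "ln (exp (- b) * Z n (t + \<sigma> * \<eta>)) \<le> ln (Z n t / 4)"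
      using Z_pos[of n t] Z_pos[of n "t + \<sigma> * \<eta>"] by (simp add: ln_mult ln_div)
    then have le: "exp (- b) * Z n (t + \<sigma> * \<eta>) \<le> Z n t / 4"
      using Z_pos[of n t] Z_pos[of n "t + \<sigma> * \<eta>"] by simp
    have "{p \<in> P n. \<epsilon> * real n \<le> \<sigma> * (real (h p) - a t * real n)} =
        {p \<in> P n. b \<le> (\<sigma> * \<eta>) * real (h p)}"
    proof -
      have "\<epsilon> * real n \<le> \<sigma> * (real (h p) - a t * real n) \<longleftrightarrow>
         \<eta> * (\<epsilon> * real n) \<le> \<eta> * (\<sigma> * (real (h p) - a t * real n))" for p
        using \<eta>(1) by simp
      then show ?thesis by (auto simp: b_def algebra_simps)
    qed
    then show ?case using tail_bound[where b = b and \<eta> = "\<sigma> * \<eta>" and n = n and t = t] le by simp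
  qed
qed

lemma concentration:
  assumes "0 < \<epsilon>"
  shows "\<forall>\<^sub>F n in sequentially. Z n t / 2 \<le>
    (\<Sum>p\<in>{p \<in> P n. \<bar>real (h p) - a t * real n\<bar> < \<epsilon> * real n}. exp (t * real (h p)))"
  using tail_negligible[where \<sigma> = 1 and t = t, OF disjI1[OF refl] assms]
    tail_negligible[where \<sigma> = "-1" and t = t, OF disjI2[OF refl] assms]
proof eventually_elim
  case (elim n)
  let ?w = "\<lambda>p. exp (t * real (h p))"
  let ?M = "{p \<in> P n. \<bar>real (h p) - a t * real n\<bar> < \<epsilon> * real n}"
  let ?U = "{p \<in> P n. \<epsilon> * real n \<le> real (h p) - a t * real n}"
  let ?D = "{p \<in> P n. \<epsilon> * real n \<le> a t * real n - real (h p)}"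
  have "Z n t = sum ?w (?M \<union> (?U \<union> ?D))"
    unfolding Z_def by (rule sum.cong) auto
  also have "\<dots> \<le> sum ?w ?M + sum ?w (?U \<union> ?D)"
    using fin by (subst sum.union_disjoint) auto
  also have "sum ?w (?U \<union> ?D) \<le> sum ?w ?U + sum ?w ?D"
    using fin[of n] by (simp add: sum_Un sum_nonneg)
  finally show ?case using elim by simp
qed

text \<open>Moving the tilt from \<open>s\<close> to \<open>u\<close> multiplies the weight of
  \<open>p\<close> by \<open>exp ((u - s) * h p)\<close>. On the pairs where the weights at
  \<open>s\<close> concentrate this is at least
  \<open>exp (n * ((u - s) * a s - \<bar>u - s\<bar> * \<epsilon>))\<close>, and they carry half of
  \<open>Z n s\<close>.\<close>

lemma tangent_below: "F s + (u - s) * a s \<le> F u"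
proof (rule field_le_epsilon)
  fix e :: real assume e: "0 < e"
  \<comment> \<open>The \<open>+ 1\<close> keeps the denominator positive when
    \<open>u = s\<close>.\<close>
  define \<epsilon> where "\<epsilon> = e / (\<bar>u - s\<bar> + 1)"
  have \<epsilon>: "0 < \<epsilon>" "\<bar>u - s\<bar> * \<epsilon> \<le> e" using e by (auto simp: \<epsilon>_def field_simps)
  have "F s + (u - s) * a s - \<bar>u - s\<bar> * \<epsilon> \<le> F u"
  proof (rule tendsto_le[OF sequentially_bot Z_growth])
    show "(\<lambda>n. ln (1 / 2) / real n + ln (Z n s) / real n + ((u - s) * a s - \<bar>u - s\<bar> * \<epsilon>))
        \<longlonglongrightarrow> F s + (u - s) * a s - \<bar>u - s\<bar> * \<epsilon>"
      by (rule tendsto_eq_intros lim_const_over_n Z_growth | simp)+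
    show "\<forall>\<^sub>F n in sequentially. ln (1 / 2) / real n + ln (Z n s) / real n +
        ((u - s) * a s - \<bar>u - s\<bar> * \<epsilon>) \<le> ln (Z n u) / real n"
      using concentration[OF \<epsilon>(1), of s] eventually_gt_at_top[of 0]
    proof eventually_elim
      case (elim n)
      let ?M = "{p \<in> P n. \<bar>real (h p) - a s * real n\<bar> < \<epsilon> * real n}"
      define c where "c = (u - s) * a s * real n - \<bar>u - s\<bar> * \<epsilon> * real n"
      have "exp c * (Z n s / 2) \<le> exp c * (\<Sum>p\<in>?M. exp (s * real (h p)))"
        using elim by (intro mult_left_mono) auto
      also have "\<dots> = (\<Sum>p\<in>?M. exp (c + s * real (h p)))"
        by (simp add: sum_distrib_left exp_add)
      also have "\<dots> \<le> (\<Sum>p\<in>?M. exp (u * real (h p)))"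
      proof (intro sum_mono)
        fix p assume p: "p \<in> ?M"
        have "- ((u - s) * (real (h p) - a s * real n)) \<le> \<bar>u - s\<bar> * \<bar>real (h p) - a s * real n\<bar>"
          by (metis abs_ge_minus_self abs_mult)
        also have "\<dots> \<le> \<bar>u - s\<bar> * (\<epsilon> * real n)"
          using p by (intro mult_left_mono) auto
        finally have "c + s * real (h p) \<le> u * real (h p)" by (simp add: c_def algebra_simps)
        then show "exp (c + s * real (h p)) \<le> exp (u * real (h p))" by simp
      qed
      also have "\<dots> \<le> Z n u" unfolding Z_def using fin by (intro sum_mono2) auto
      finally have "ln (exp c * (Z n s / 2)) \<le> ln (Z n u)" using Z_pos[of n s] Z_pos[of n u] by simp
      then have "c + (ln (1 / 2) + ln (Z n s)) \<le> ln (Z n u)"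
        using Z_pos[of n s] by (simp add: ln_mult ln_div)
      then have "(c + (ln (1 / 2) + ln (Z n s))) / real n \<le> ln (Z n u) / real n"
        by (rule divide_right_mono) simp
      moreover have "c / real n = (u - s) * a s - \<bar>u - s\<bar> * \<epsilon>"
        using elim(2) by (simp add: c_def diff_divide_distrib)
      ultimately show ?case by (simp only: add_divide_distrib)
    qed
  qed
  then show "F s + (u - s) * a s \<le> F u + e" using \<epsilon> by linarith
qed

text \<open>Add the tangent inequalities at \<open>s\<close> and at \<open>u\<close>.\<close>

lemma slope_mono: "s \<le> u \<Longrightarrow> a s \<le> a u"
proof (cases "s = u")
  case False
  assume "s \<le> u"
  then have "0 < u - s" using False by simp
  moreover have "(u - s) * a s \<le> (u - s) * a u"
    using tangent_below[of s u] tangent_below[of u s] by (simp add: algebra_simps)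
  ultimately show ?thesis by simp
qed simp

section \<open>Counting elements below a linear threshold\<close>

definition cnt :: "nat \<Rightarrow> nat \<Rightarrow> nat" where
  "cnt n d = card {p \<in> P n. h p \<le> d}"

lemma cnt_mono: "d \<le> d' \<Longrightarrow> cnt n d \<le> cnt n d'"
  unfolding cnt_def using fin by (intro card_mono) auto

text \<open>Chernoff bound: since \<open>t\<close> is nonpositive, a small \<open>h p\<close> makes
  \<open>t * h p\<close> large, so \<open>tail_bound\<close> applies with base tilt 0.\<close>

lemma cnt_upper:
  assumes "t \<le> 0" "real d \<le> b"
  shows "real (cnt n d) \<le> exp (- (t * b)) * Z n t"
proof -
  have "real (cnt n d) = (\<Sum>p\<in>{p \<in> P n. h p \<le> d}. exp (0 * real (h p)))"
    by (simp add: cnt_def)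
  also have "\<dots> \<le> (\<Sum>p\<in>{p \<in> P n. t * b \<le> t * real (h p)}. exp (0 * real (h p)))"
  proof (rule sum_mono2)
    show "{p \<in> P n. h p \<le> d} \<subseteq> {p \<in> P n. t * b \<le> t * real (h p)}"
      using assms by (auto intro!: mult_left_mono_neg)
  qed (use fin in auto)
  also have "\<dots> \<le> exp (- (t * b)) * Z n (0 + t)" by (rule tail_bound)
  finally show ?thesis by simp
qed

text \<open>The elements where the weights at \<open>s\<close> concentrate lie below the threshold
  because \<open>a s < \<delta>\<close>. They carry half of \<open>Z n s\<close>, and each weighs at
  most \<open>exp (s * (a s - \<epsilon>) * n)\<close>, which bounds their number from
  below.\<close>

lemma cnt_lower:
  assumes s: "s \<le> 0" "a s < \<delta>" and e: "0 < e"
  shows "\<forall>\<^sub>F n in sequentially.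
    F s - s * a s - e < ln (real (cnt n (nat \<lfloor>\<delta> * real n\<rfloor> - 1))) / real n"
proof -
  \<comment> \<open>The first bound keeps the window below the threshold with room to spare, the
    second keeps the loss \<open>- s * \<epsilon>\<close> below \<open>e\<close>.\<close>
  define \<epsilon> where "\<epsilon> = min ((\<delta> - a s) / 2) (e / 2 / (\<bar>s\<bar> + 1))"
  have "0 < e / 2 / (\<bar>s\<bar> + 1)" using e by (intro divide_pos_pos) auto
  then have \<epsilon>: "0 < \<epsilon>" "\<epsilon> \<le> (\<delta> - a s) / 2" "\<epsilon> \<le> e / 2 / (\<bar>s\<bar> + 1)"
    using s(2) unfolding \<epsilon>_def min_less_iff_conj
    by (simp, intro min.cobounded1, intro min.cobounded2)
  have "\<bar>s\<bar> * \<epsilon> \<le> \<bar>s\<bar> * (e / 2 / (\<bar>s\<bar> + 1))"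
    by (rule mult_left_mono[OF \<epsilon>(3)]) simp
  also have "\<dots> < e"
  proof -
    have "0 < e * \<bar>s\<bar> + e * 2" using e by (intro add_nonneg_pos) auto
    then have "\<bar>s\<bar> * e < e * (\<bar>s\<bar> + 1) * 2" by (simp add: algebra_simps)
    then show ?thesis by (simp add: field_simps)
  qed
  finally have \<epsilon>s: "- s * \<epsilon> < e" using s by simp
  have "(\<lambda>n. ln (1 / 2) / real n + ln (Z n s) / real n - s * (a s - \<epsilon>)) \<longlonglongrightarrow> F s - s * (a s - \<epsilon>)"
    by (rule tendsto_eq_intros lim_const_over_n Z_growth | simp)+
  moreover have "F s - s * a s - e < F s - s * (a s - \<epsilon>)" using \<epsilon>s by (simp add: algebra_simps)
  ultimately have "\<forall>\<^sub>F n in sequentially.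
     F s - s * a s - e < ln (1 / 2) / real n + ln (Z n s) / real n - s * (a s - \<epsilon>)"
    by (rule order_tendstoD(1))
  \<comment> \<open>Yields a slack of 2 in the distance, enough for the floor and for the
    \<open>- 1\<close> in the radius.\<close>
  moreover have "\<forall>\<^sub>F n in sequentially. 2 / \<epsilon> < real n"
    using filterlim_real_sequentially by (simp add: filterlim_at_top_dense)
  ultimately show ?thesis using concentration[OF \<epsilon>(1), of s] eventually_gt_at_top[of 0]
  proof eventually_elim
    case (elim n)
    let ?M = "{p \<in> P n. \<bar>real (h p) - a s * real n\<bar> < \<epsilon> * real n}"
    let ?d = "nat \<lfloor>\<delta> * real n\<rfloor> - 1"
    have sub: "h p \<le> ?d" if "p \<in> ?M" for p
    proof -
      have "real (h p) < a s * real n + \<epsilon> * real n" using that by auto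
      moreover have "2 < \<epsilon> * real n" using elim(2) \<epsilon> by (simp add: field_simps)
      moreover have "2 * \<epsilon> * real n \<le> (\<delta> - a s) * real n"
        using \<epsilon>(2) by (intro mult_right_mono) auto
      ultimately have "real (h p) + 2 \<le> \<delta> * real n" by (simp add: algebra_simps)
      then have "int (h p) + 2 \<le> \<lfloor>\<delta> * real n\<rfloor>" by (simp add: le_floor_iff)
      then show ?thesis by linarith
    qed
    have "exp (- s * (a s - \<epsilon>) * real n) * (Z n s / 2)
        \<le> exp (- s * (a s - \<epsilon>) * real n) * (\<Sum>p\<in>?M. exp (s * real (h p)))"
      using elim by (intro mult_left_mono) auto
    also have "\<dots> = (\<Sum>p\<in>?M. exp (s * real (h p) - s * (a s - \<epsilon>) * real n))"
      by (simp add: sum_distrib_left exp_add[symmetric] algebra_simps)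
    also have "\<dots> \<le> (\<Sum>p\<in>?M. 1)"
    proof (intro sum_mono)
      fix p assume "p \<in> ?M"
      then have "(a s - \<epsilon>) * real n \<le> real (h p)" by (auto simp: algebra_simps)
      then have "s * real (h p) \<le> s * ((a s - \<epsilon>) * real n)"
        using s by (intro mult_left_mono_neg) auto
      then show "exp (s * real (h p) - s * (a s - \<epsilon>) * real n) \<le> 1" by simp
    qed
    also have "\<dots> \<le> real (cnt n ?d)"
      using sub fin by (auto simp: cnt_def intro!: card_mono)
    finally have le: "exp (- s * (a s - \<epsilon>) * real n) * (Z n s / 2) \<le> real (cnt n ?d)" .
    have "0 < exp (- s * (a s - \<epsilon>) * real n) * (Z n s / 2)" using Z_pos[of n s] by simp
    with le have "ln (exp (- s * (a s - \<epsilon>) * real n) * (Z n s / 2)) \<le> ln (real (cnt n ?d))"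
      by (subst ln_le_cancel_iff) linarith+
    then have "- s * (a s - \<epsilon>) * real n + (ln (1 / 2) + ln (Z n s)) \<le> ln (real (cnt n ?d))"
      using Z_pos[of n s] by (simp add: ln_mult ln_div)
    then have "(- s * (a s - \<epsilon>) * real n + (ln (1 / 2) + ln (Z n s))) / real n
        \<le> ln (real (cnt n ?d)) / real n" by (rule divide_right_mono) simp
    then have "ln (1 / 2) / real n + ln (Z n s) / real n - s * (a s - \<epsilon>) \<le> ln (real (cnt n ?d)) / real n"
      using elim(4) by (simp add: add_divide_distrib diff_divide_distrib)
    then show ?case using elim(1) by linarith
  qed
qed

text \<open>The upper bound tilts by \<open>t\<close> itself. For the lower bound the concentration
  window must lie strictly below the threshold, so \<open>cnt_lower\<close> is used at a slope
  slightly less than \<open>a t\<close>, provided by \<open>ivt\<close>.\<close>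

lemma cnt_growth:
  assumes t: "t \<le> 0" "0 < a t" and ivt: "\<And>b. 0 < b \<Longrightarrow> b < a t \<Longrightarrow> \<exists>s. a s = b"
    and pos: "\<And>n. 0 < cnt n 0"
  shows "(\<lambda>n. ln (real (cnt n (nat \<lfloor>a t * real n\<rfloor> - 1))) / real n) \<longlonglongrightarrow> F t - t * a t"
proof (rule order_tendstoI)
  let ?c = "\<lambda>n. real (cnt n (nat \<lfloor>a t * real n\<rfloor> - 1))"
  fix b assume b: "F t - t * a t < b"
  have cpos: "0 < ?c n" for n
    using pos[of n] cnt_mono[of 0 "nat \<lfloor>a t * real n\<rfloor> - 1" n] by simp
  have "(\<lambda>n. ln (Z n t) / real n - t * a t) \<longlonglongrightarrow> F t - t * a t"
    by (intro tendsto_intros Z_growth)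
  then have "\<forall>\<^sub>F n in sequentially. ln (Z n t) / real n - t * a t < b"
    using b by (rule order_tendstoD)
  then show "\<forall>\<^sub>F n in sequentially. ln (?c n) / real n < b"
    using eventually_gt_at_top[of 0]
  proof eventually_elim
    case (elim n)
    have "0 \<le> a t * real n" using t by simp
    then have "real (nat \<lfloor>a t * real n\<rfloor> - 1) \<le> a t * real n" by linarith
    then have "?c n \<le> exp (- (t * (a t * real n))) * Z n t" by (rule cnt_upper[OF t(1)])
    then have "ln (?c n) \<le> ln (exp (- (t * (a t * real n))) * Z n t)"
      using cpos[of n] by (subst ln_le_cancel_iff) (auto simp: Z_pos)
    then have "ln (?c n) \<le> - (t * (a t * real n)) + ln (Z n t)"
      using Z_pos[of n t] by (simp add: ln_mult)
    then have "ln (?c n) / real n \<le> ln (Z n t) / real n - t * a t"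
      using elim(2) by (simp add: field_simps)
    then show ?case using elim(1) by linarith
  qed
next
  let ?c = "\<lambda>n. real (cnt n (nat \<lfloor>a t * real n\<rfloor> - 1))"
  fix b assume b: "b < F t - t * a t"
  define e where "e = F t - t * a t - b"
  have e: "0 < e" using b by (simp add: e_def)
  obtain s0 where s0: "a s0 = a t / 2" using ivt[of "a t / 2"] t by auto
  \<comment> \<open>By monotonicity, slopes close to \<open>a t\<close> are attained only at points \<open>s\<close> of \<open>[s0, t]\<close>,
    so the loss \<open>\<eta> * s\<close> vanishes with \<open>\<eta>\<close>.\<close>
  define \<eta> where "\<eta> = min (a t / 4) (e / 2 / (\<bar>s0\<bar> + 1))"
  have "0 < e / 2 / (\<bar>s0\<bar> + 1)" using e by (intro divide_pos_pos) auto
  then have \<eta>: "0 < \<eta>" "\<eta> \<le> a t / 4" "\<eta> \<le> e / 2 / (\<bar>s0\<bar> + 1)"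
    using t(2) unfolding \<eta>_def min_less_iff_conj
    by (simp, intro min.cobounded1, intro min.cobounded2)
  obtain s where s: "a s = a t - \<eta>" using ivt[of "a t - \<eta>"] \<eta> t by auto
  have st: "s < t" using slope_mono[of t s] s \<eta> by (cases "s < t") auto
  have "s0 < s" using slope_mono[of s s0] s s0 \<eta> t by (cases "s0 < s") auto
  then have "- s * \<eta> \<le> \<bar>s0\<bar> * \<eta>" using \<eta> st t by (intro mult_right_mono) auto
  also have "\<dots> \<le> \<bar>s0\<bar> * (e / 2 / (\<bar>s0\<bar> + 1))"
    by (rule mult_left_mono[OF \<eta>(3)]) simp
  also have "\<dots> \<le> e / 2" using e by (simp add: field_simps)
  finally have loss: "- s * \<eta> \<le> e / 2" .
  have "\<forall>\<^sub>F n in sequentially. F s - s * a s - e / 2 < ln (?c n) / real n"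
    using st t s \<eta> e by (intro cnt_lower) auto
  moreover have "b \<le> F s - s * a s - e / 2"
  proof -
    \<comment> \<open>The tangent at \<open>t\<close> evaluated at \<open>s\<close>, rewritten with
      \<open>a s = a t - \<eta>\<close>.\<close>
    have "F t - t * a t + s * \<eta> \<le> F s - s * a s"
      using tangent_below[of t s] by (simp add: s algebra_simps)
    moreover have "- (s * \<eta>) \<le> e / 2" using loss by simp
    moreover have "F t - t * a t = b + e" by (simp add: e_def)
    ultimately show ?thesis by linarith
  qed
  ultimately show "\<forall>\<^sub>F n in sequentially. b < ln (?c n) / real n"
    by (auto elim: eventually_mono)
qed

end

section \<open>Words and the distance matrix\<close>

lemma is_path_Nil: "is_path src tgt []"
  by (simp add: is_path_def)

lemma is_path_Cons:
  "is_path src tgt (e # es) \<longleftrightarrow> is_path src tgt es \<and> (es \<noteq> [] \<longrightarrow> tgt e = src (hd es))"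
proof
  assume L: "is_path src tgt (e # es)"
  have "tgt (es ! i) = src (es ! Suc i)" if "Suc i < length es" for i
    using L[unfolded is_path_def, rule_format, of "Suc i"] that by simp
  moreover have "tgt e = src (hd es)" if "es \<noteq> []"
    using L[unfolded is_path_def, rule_format, of 0] that by (simp add: hd_conv_nth)
  ultimately show "is_path src tgt es \<and> (es \<noteq> [] \<longrightarrow> tgt e = src (hd es))"
    by (auto simp: is_path_def)
next
  assume R: "is_path src tgt es \<and> (es \<noteq> [] \<longrightarrow> tgt e = src (hd es))"
  show "is_path src tgt (e # es)"
    unfolding is_path_def
  proof (intro allI impI)
    fix i assume "Suc i < length (e # es)"
    then show "tgt ((e # es) ! i) = src ((e # es) ! Suc i)"
      using R by (cases i) (auto simp: is_path_def hd_conv_nth)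
  qed
qed

lemma hamming_Nil: "hamming [] [] = 0"
  by (simp add: hamming_def)

lemma hamming_Cons: "hamming (a # x) (b # y) = (if a = b then 0 else 1) + hamming x y"
proof -
  have "{i. i < length (a # x) \<and> (a # x) ! i \<noteq> (b # y) ! i} =
      (if a = b then {} else {0}) \<union> Suc ` {i. i < length x \<and> x ! i \<noteq> y ! i}"
    by (auto simp: less_Suc_eq_0_disj image_iff)
  then show ?thesis
    by (simp add: hamming_def card_image card_insert_if image_iff)
qed

lemma hamming_le_length: "hamming x y \<le> length x"
proof -
  have "hamming x y \<le> card {..<length x}" unfolding hamming_def by (intro card_mono) auto
  then show ?thesis by simp
qed

lemma hamming_eq_0_iff: "length x = length y \<Longrightarrow> hamming x y = 0 \<longleftrightarrow> x = y"
  by (auto simp: hamming_def nth_equalityI)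

text \<open>Rates are proved below as genuine limits in natural logarithms; this is the bridge to
  the base 2 limsups of the definitions.\<close>

lemma limsup_log:
  assumes "(\<lambda>n. ln (f n) / real n) \<longlonglongrightarrow> l"
  shows "real_of_ereal (limsup (\<lambda>n. ereal (log 2 (f n) / real n))) = l / ln 2"
proof -
  have "(\<lambda>n. ln (f n) / real n / ln 2) \<longlonglongrightarrow> l / ln 2" by (intro tendsto_intros assms) simp
  then have "(\<lambda>n. log 2 (f n) / real n) \<longlonglongrightarrow> l / ln 2" by (simp add: log_def field_simps)
  then have "(\<lambda>n. ereal (log 2 (f n) / real n)) \<longlonglongrightarrow> ereal (l / ln 2)" by simp
  from lim_imp_Limsup[OF _ this] show ?thesis by simp
qed

locale presentation =
  fixes src tgt :: "'e::finite \<Rightarrow> 'v::{finite,linorder}" and lab :: "'e \<Rightarrow> bool"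
  assumes det: "deterministic src lab" and prim: "primitive src tgt"
begin

abbreviation S where "S \<equiv> words src tgt lab"

text \<open>Words are sorted by the initial state of a path reading them, so that the recursion on
  the first edge matches one multiplication by the distance matrix.\<close>

primrec lang :: "nat \<Rightarrow> 'v \<Rightarrow> bool list set" where
  "lang 0 u = {[]}"
| "lang (Suc n) u = (\<Union>e\<in>{e. src e = u}. (#) (lab e) ` lang n (tgt e))"

lemma lang_iff:
  "w \<in> lang n u \<longleftrightarrow> (\<exists>es. length es = n \<and> is_path src tgt es \<and> (es \<noteq> [] \<longrightarrow> src (hd es) = u) \<and> map lab es = w)"
proof (induction n arbitrary: u w)
  case 0
  then show ?case by (auto simp: is_path_Nil)
next
  case (Suc n)
  show ?case
  proof
    assume "w \<in> lang (Suc n) u"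
    then obtain e w' where e: "src e = u" "w = lab e # w'" "w' \<in> lang n (tgt e)" by auto
    then obtain es where "length es = n" "is_path src tgt es" "es \<noteq> [] \<longrightarrow> src (hd es) = tgt e"
      "map lab es = w'" using Suc.IH by blast
    then show "\<exists>es. length es = Suc n \<and> is_path src tgt es \<and> (es \<noteq> [] \<longrightarrow> src (hd es) = u) \<and> map lab es = w"
      using e by (intro exI[of _ "e # es"]) (auto simp: is_path_Cons)
  next
    assume "\<exists>es. length es = Suc n \<and> is_path src tgt es \<and> (es \<noteq> [] \<longrightarrow> src (hd es) = u) \<and> map lab es = w"
    then obtain e es where es: "length es = n" "is_path src tgt (e # es)" "src e = u"
      "w = lab e # map lab es" by (auto simp: length_Suc_conv)
    then have "map lab es \<in> lang n (tgt e)" unfolding Suc.IH by (auto simp: is_path_Cons)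
    then show "w \<in> lang (Suc n) u" using es by auto
  qed
qed

lemma words_eq: "S n = (\<Union>u. lang n u)"
proof
  show "S n \<subseteq> (\<Union>u. lang n u)"
  proof
    fix w assume "w \<in> S n"
    then obtain es where "w = map lab es" "is_path src tgt es" "length es = n"
      unfolding words_def by blast
    then have "w \<in> lang n (src (hd es))" unfolding lang_iff by blast
    then show "w \<in> (\<Union>u. lang n u)" by blast
  qed
  show "(\<Union>u. lang n u) \<subseteq> S n" by (auto simp: words_def lang_iff)
qed

lemma length_lang: "w \<in> lang n u \<Longrightarrow> length w = n"
  by (auto simp: lang_iff)

lemma finite_lang: "finite (lang n u)"
  by (induction n arbitrary: u) auto

lemma finite_S: "finite (S n)"
  by (auto simp: words_eq finite_lang)

lemma length_S: "w \<in> S n \<Longrightarrow> length w = n"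
  by (auto simp: words_eq length_lang)

lemma ex_edge: "\<exists>e. src e = u"
  using prim unfolding primitive_def path_from_to_def by blast

lemma lang_nonempty: "lang n u \<noteq> {}"
  using ex_edge by (induction n arbitrary: u) auto

lemma S_nonempty: "S n \<noteq> {}"
  using lang_nonempty by (auto simp: words_eq)

text \<open>Determinism enters here: edges leaving \<open>u\<close> have different labels, so the
  words split disjointly by their first edge.\<close>

lemma sum_lang_Suc:
  fixes f :: "bool list \<Rightarrow> real"
  shows "(\<Sum>w\<in>lang (Suc n) u. f w) = (\<Sum>e | src e = u. \<Sum>w\<in>lang n (tgt e). f (lab e # w))"
proof -
  have "(\<Sum>w\<in>lang (Suc n) u. f w) = (\<Sum>e | src e = u. \<Sum>w\<in>(#) (lab e) ` lang n (tgt e). f w)"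
    using det unfolding lang.simps
    by (intro sum.UNION_disjoint) (auto simp: finite_lang deterministic_def)
  also have "\<dots> = (\<Sum>e | src e = u. \<Sum>w\<in>lang n (tgt e). f (lab e # w))"
    by (rule sum.cong[OF refl]) (subst sum.reindex, auto)
  finally show ?thesis .
qed

lemma sum_dist_matrix:
  "(\<Sum>q\<in>UNIV. dist_matrix src tgt lab y p q * f q) =
   (\<Sum>e | src e = fst p. \<Sum>e' | src e' = snd p.
      y ^ (if lab e = lab e' then 0 else 1) * f (tgt e, tgt e'))"
proof -
  let ?g = "\<lambda>e e'. y ^ (if lab e = lab e' then 0 else 1) * f (tgt e, tgt e')"
  let ?A = "\<lambda>v. {e \<in> {e. src e = fst p}. tgt e = v}"
  let ?B = "\<lambda>v. {e \<in> {e. src e = snd p}. tgt e = v}"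
  have "(\<Sum>q\<in>UNIV. dist_matrix src tgt lab y p q * f q) =
      (\<Sum>v\<in>UNIV. \<Sum>v'\<in>UNIV. dist_matrix src tgt lab y p (v, v') * f (v, v'))"
    by (simp add: sum.cartesian_product UNIV_Times_UNIV[symmetric] del: UNIV_Times_UNIV)
  also have "\<dots> = (\<Sum>v\<in>UNIV. \<Sum>v'\<in>UNIV. \<Sum>e\<in>?A v. \<Sum>e'\<in>?B v'. ?g e e')"
    by (intro sum.cong refl) (auto simp: dist_matrix_def sum_distrib_right intro!: sum.cong)
  also have "\<dots> = (\<Sum>v\<in>UNIV. \<Sum>e\<in>?A v. \<Sum>v'\<in>UNIV. \<Sum>e'\<in>?B v'. ?g e e')"
    by (intro sum.cong refl sum.swap)
  also have "\<dots> = (\<Sum>v\<in>UNIV. \<Sum>e\<in>?A v. \<Sum>e' | src e' = snd p. ?g e e')"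
    by (intro sum.cong refl sum.group) auto
  also have "\<dots> = (\<Sum>e | src e = fst p. \<Sum>e' | src e' = snd p. ?g e e')"
    by (intro sum.group) auto
  finally show ?thesis .
qed

section \<open>Powers of the distance matrix\<close>

definition Tm :: "real \<Rightarrow> real^('v \<times> 'v)^('v \<times> 'v)" where
  "Tm y = (\<chi> p q. dist_matrix src tgt lab y p q)"

lemma Tm_mult: "(Tm y *v x) $ p = (\<Sum>q\<in>UNIV. dist_matrix src tgt lab y p q * x $ q)"
  by (simp add: Tm_def matrix_vector_mult_def)

lemma nonneg_Tm: "0 \<le> y \<Longrightarrow> nonneg_mat (Tm y)"
  by (auto simp: nonneg_mat_def Tm_def dist_matrix_def intro!: sum_nonneg)

text \<open>Single-letter labels differ in at most one place, so \<open>y\<close> occurs only to the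
  powers 0 and 1. This is the affine form required by
  \<open>perron_val_has_derivative\<close>.\<close>

lemma Tm_affine: "Tm y = Tm 0 + y *\<^sub>R (Tm 1 - Tm 0)"
proof -
  have "y ^ (if b then 0 else 1) = 0 ^ (if b then 0 else 1) + y * (1 ^ (if b then 0 else 1) - 0 ^ (if b then 0 else 1))"
    for b and y :: real by simp
  note * = this[of y "lab e = lab e'" for e e']
  show ?thesis
    unfolding vec_eq_iff Tm_def dist_matrix_def
    by (subst *) (simp add: sum.distrib sum_distrib_left sum_subtractf right_diff_distrib)
qed

lemma continuous_on_Tm: "continuous_on A Tm"
  by (subst Tm_affine[abs_def]) (intro continuous_intros)

text \<open>Each factor reads one more letter of both words, and the Hamming distance is additive
  over letters.\<close>

lemma matpow_Tm_one:
  "(matpow (Tm y) n *v 1) $ p = (\<Sum>w\<in>lang n (fst p). \<Sum>w'\<in>lang n (snd p). y ^ hamming w w')"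
proof (induction n arbitrary: p)
  case 0
  then show ?case by (simp add: hamming_Nil)
next
  case (Suc n)
  have "(matpow (Tm y) (Suc n) *v 1) $ p =
      (\<Sum>e | src e = fst p. \<Sum>e' | src e' = snd p. y ^ (if lab e = lab e' then 0 else 1) *
         (matpow (Tm y) n *v 1) $ (tgt e, tgt e'))"
    by (simp add: matrix_vector_mul_assoc[symmetric] Tm_mult sum_dist_matrix[where p = p])
  also have "\<dots> = (\<Sum>e | src e = fst p. \<Sum>e' | src e' = snd p.
      \<Sum>w\<in>lang n (tgt e). \<Sum>w'\<in>lang n (tgt e'). y ^ hamming (lab e # w) (lab e' # w'))"
    by (intro sum.cong refl) (simp add: Suc.IH sum_distrib_left hamming_Cons power_add)
  also have "\<dots> = (\<Sum>e | src e = fst p. \<Sum>w\<in>lang n (tgt e). \<Sum>e' | src e' = snd p.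
      \<Sum>w'\<in>lang n (tgt e'). y ^ hamming (lab e # w) (lab e' # w'))"
    by (intro sum.cong refl sum.swap)
  also have "\<dots> = (\<Sum>w\<in>lang (Suc n) (fst p). \<Sum>w'\<in>lang (Suc n) (snd p). y ^ hamming w w')"
    by (simp only: sum_lang_Suc)
  finally show ?case .
qed

text \<open>Two paths of equal length run in parallel form a path of positive weight on pairs of
  states. The conditions for empty lists serve the base case.\<close>

lemma matpow_Tm_pos:
  assumes "0 < y" "length es = n" "length es' = n"
    "is_path src tgt es" "is_path src tgt es'" "es \<noteq> [] \<Longrightarrow> src (hd es) = u" "es' \<noteq> [] \<Longrightarrow> src (hd es') = u'"
    "if es = [] then u = v else tgt (last es) = v" "if es' = [] then u' = v' else tgt (last es') = v'"
  shows "0 < matpow (Tm y) n $ (u, u') $ (v, v')"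
  using assms
proof (induction n arbitrary: es es' u u')
  case 0
  then show ?case by (simp add: mat_def)
next
  case (Suc n)
  obtain e fs where es: "es = e # fs" "length fs = n" using Suc.prems by (auto simp: length_Suc_conv)
  obtain e' fs' where es': "es' = e' # fs'" "length fs' = n" using Suc.prems by (auto simp: length_Suc_conv)
  let ?q = "(tgt e, tgt e')"
  have nn: "nonneg_mat (Tm y)" using Suc.prems by (intro nonneg_Tm) auto
  have "0 < matpow (Tm y) n $ ?q $ (v, v')"
    using Suc.prems es es' by (intro Suc.IH[of fs fs']) (auto simp: is_path_Cons)
  moreover have "0 < Tm y $ (u, u') $ ?q"
  proof -
    have e: "src e = u" "src e' = u'" using Suc.prems es es' by auto
    have "0 < (\<Sum>a\<in>{a. src a = u' \<and> tgt a = tgt e'}. y ^ (if lab e = lab a then 0 else 1))"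
      using Suc.prems(1) e by (intro sum_pos2[of _ e']) auto
    then show ?thesis unfolding Tm_def dist_matrix_def using Suc.prems(1) e
      by (auto intro!: sum_pos2[of _ e] sum_nonneg)
  qed
  ultimately have "0 < Tm y $ (u, u') $ ?q * matpow (Tm y) n $ ?q $ (v, v')" by simp
  also have "\<dots> \<le> (\<Sum>q\<in>UNIV. Tm y $ (u, u') $ q * matpow (Tm y) n $ q $ (v, v'))"
    using nn nonneg_matpow[OF nn, of n]
    by (intro member_le_sum) (auto simp: nonneg_mat_def)
  finally show ?case by (simp add: matrix_matrix_mult_def)
qed

lemma primitive_Tm:
  assumes "0 < y"
  shows "primitive_mat (Tm y)"
proof -
  obtain m where m: "m > 0" "\<And>u v. \<exists>es. length es = m \<and> path_from_to src tgt u v es"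
    using prim unfolding primitive_def by blast
  have "0 < matpow (Tm y) m $ (u, u') $ (v, v')" for u u' v v'
  proof -
    obtain es es' where "length es = m" "path_from_to src tgt u v es"
      "length es' = m" "path_from_to src tgt u' v' es'" using m(2) by metis
    then show ?thesis using assms by (intro matpow_Tm_pos[of y es m es']) (auto simp: path_from_to_def)
  qed
  then show ?thesis using m(1) nonneg_Tm[of y] assms by (auto simp: primitive_mat_def)
qed

section \<open>Weighted pairs of words\<close>

abbreviation Q where "Q n \<equiv> S n \<times> S n"

definition pair_hamming :: "bool list \<times> bool list \<Rightarrow> nat" where
  "pair_hamming p = hamming (fst p) (snd p)"

definition N :: "nat \<Rightarrow> real \<Rightarrow> real" where
  "N n y = (\<Sum>p\<in>Q n. y ^ pair_hamming p)"

lemma row_total_Tm: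
  "row_total (Tm y) n = (\<Sum>p\<in>UNIV. \<Sum>z\<in>lang n (fst p) \<times> lang n (snd p). y ^ pair_hamming z)"
  by (simp add: row_total_def matpow_Tm_one sum.cartesian_product pair_hamming_def case_prod_unfold)

text \<open>Every pair of words can be read from at least one pair of initial states. The companion
  bound below uses that there are only \<open>CARD('v \<times> 'v)\<close> such pairs of
  states.\<close>

lemma N_le_row_total:
  assumes "0 \<le> y"
  shows "N n y \<le> row_total (Tm y) n"
proof -
  let ?L = "\<lambda>p. lang n (fst p) \<times> lang n (snd p)"
  have "N n y \<le> (\<Sum>z\<in>Q n. \<Sum>p\<in>UNIV. if z \<in> ?L p then y ^ pair_hamming z else 0)"
    unfolding N_def
  proof (rule sum_mono)
    fix z assume "z \<in> Q n"
    then obtain p where p: "z \<in> ?L p" by (auto simp: words_eq)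
    have "y ^ pair_hamming z = (if z \<in> ?L p then y ^ pair_hamming z else 0)" using p by simp
    also have "\<dots> \<le> (\<Sum>p\<in>UNIV. if z \<in> ?L p then y ^ pair_hamming z else 0)"
      using assms by (intro member_le_sum[of p]) auto
    finally show "y ^ pair_hamming z \<le> (\<Sum>p\<in>UNIV. if z \<in> ?L p then y ^ pair_hamming z else 0)" .
  qed
  also have "\<dots> = (\<Sum>p\<in>UNIV. \<Sum>z\<in>Q n. if z \<in> ?L p then y ^ pair_hamming z else 0)" by (rule sum.swap)
  also have "\<dots> = (\<Sum>p\<in>UNIV. \<Sum>z\<in>?L p. y ^ pair_hamming z)"
  proof (rule sum.cong[OF refl])
    fix p :: "'v \<times> 'v"
    have "?L p \<subseteq> Q n" by (auto simp: words_eq)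
    then have "Q n \<inter> ?L p = ?L p" by blast
    then show "(\<Sum>z\<in>Q n. if z \<in> ?L p then y ^ pair_hamming z else 0) = (\<Sum>z\<in>?L p. y ^ pair_hamming z)"
      using finite_S by (simp only: sum.inter_restrict[symmetric] finite_cartesian_product)
  qed
  finally show ?thesis by (simp add: row_total_Tm)
qed

lemma row_total_le_N:
  assumes "0 \<le> y"
  shows "row_total (Tm y) n \<le> real CARD('v \<times> 'v) * N n y"
proof -
  have "row_total (Tm y) n \<le> (\<Sum>p\<in>(UNIV :: ('v \<times> 'v) set). N n y)"
    unfolding row_total_Tm N_def using assms finite_S[of n]
    by (intro sum_mono sum_mono2) (auto simp: words_eq)
  then show ?thesis by simp
qed

lemma one_le_N: "0 \<le> y \<Longrightarrow> 1 \<le> N n y"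
proof -
  assume y: "0 \<le> y"
  obtain w where w: "w \<in> S n" using S_nonempty by blast
  have "1 = y ^ pair_hamming (w, w)" by (simp add: pair_hamming_def hamming_def)
  also have "\<dots> \<le> N n y" unfolding N_def using w y by (intro member_le_sum) (auto simp: finite_S)
  finally show ?thesis .
qed

lemma growth_N_iff:
  assumes y: "0 \<le> y"
  shows "((\<lambda>n. ln (row_total (Tm y) n) / real n) \<longlonglongrightarrow> g) \<longleftrightarrow> ((\<lambda>n. ln (N n y) / real n) \<longlonglongrightarrow> g)"
proof (rule Lim_transform_eq)
  let ?K = "real CARD('v \<times> 'v)"
  show "(\<lambda>n. ln (row_total (Tm y) n) / real n - ln (N n y) / real n) \<longlonglongrightarrow> 0"
  proof (rule tendsto_sandwich[of "\<lambda>_. 0" _ _ "\<lambda>n. ln ?K / real n"])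
    show "(\<lambda>n. ln ?K / real n) \<longlonglongrightarrow> 0" by (rule lim_const_over_n)
    show "\<forall>\<^sub>F n in sequentially. 0 \<le> ln (row_total (Tm y) n) / real n - ln (N n y) / real n"
    proof (intro always_eventually allI)
      fix n
      show "0 \<le> ln (row_total (Tm y) n) / real n - ln (N n y) / real n"
        using N_le_row_total[OF y, of n] one_le_N[OF y, of n] by (simp add: divide_right_mono)
    qed
    show "\<forall>\<^sub>F n in sequentially. ln (row_total (Tm y) n) / real n - ln (N n y) / real n \<le> ln ?K / real n"
    proof (intro always_eventually allI)
      fix n
      have "ln (row_total (Tm y) n) \<le> ln (?K * N n y)"
        using N_le_row_total[OF y, of n] one_le_N[OF y, of n] row_total_le_N[OF y, of n]
        by (subst ln_le_cancel_iff) linarith+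
      also have "\<dots> = ln ?K + ln (N n y)" using one_le_N[OF y, of n] by (subst ln_mult) auto
      finally have "ln (row_total (Tm y) n) - ln (N n y) \<le> ln ?K" by simp
      then show "ln (row_total (Tm y) n) / real n - ln (N n y) / real n \<le> ln ?K / real n"
        by (metis diff_divide_distrib divide_right_mono of_nat_0_le_iff)
    qed
  qed simp
qed

section \<open>Swap-symmetric vectors and the reduced matrix\<close>

lemma dist_matrix_swap:
  "dist_matrix src tgt lab y (prod.swap p) (prod.swap q) = dist_matrix src tgt lab y p q"
  unfolding dist_matrix_def by (subst sum.swap) (auto simp: eq_commute intro!: sum.cong)

text \<open>The columns \<open>(u, v)\<close> and \<open>(v, u)\<close> meet the same value of
  \<open>X\<close>, and \<open>red_matrix\<close> adds exactly these two columns.\<close>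

lemma sum_red_matrix:
  assumes "\<And>q. X (prod.swap q) = X q"
  shows "(\<Sum>q\<in>UNIV. dist_matrix src tgt lab y p q * X q) = (\<Sum>q\<in>pairs2. red_matrix src tgt lab y p q * X q)"
proof -
  let ?D = "dist_matrix src tgt lab y p"
  let ?lt = "{q::'v \<times> 'v. fst q < snd q}"
  have U: "(UNIV :: ('v \<times> 'v) set) = pairs2 \<union> prod.swap ` ?lt"
    by (auto simp: pairs2_def image_iff not_le)
  have "(\<Sum>q\<in>UNIV. ?D q * X q) = (\<Sum>q\<in>pairs2. ?D q * X q) + (\<Sum>q\<in>prod.swap ` ?lt. ?D q * X q)"
    unfolding U by (rule sum.union_disjoint) (auto simp: pairs2_def)
  also have "(\<Sum>q\<in>prod.swap ` ?lt. ?D q * X q) = (\<Sum>q\<in>?lt. ?D (prod.swap q) * X q)"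
    by (subst sum.reindex) (auto simp: assms inj_on_def)
  also have "?lt = {q \<in> pairs2. fst q < snd q}" by (auto simp: pairs2_def)
  also have "(\<Sum>q\<in>{q \<in> pairs2. fst q < snd q}. ?D (prod.swap q) * X q) =
      (\<Sum>q\<in>pairs2. if fst q < snd q then ?D (prod.swap q) * X q else 0)"
    by (rule sum.inter_filter) simp
  finally show ?thesis
    by (simp add: sum.distrib[symmetric] red_matrix_def prod.swap_def algebra_simps if_distrib
        cong: if_cong)
       (auto intro!: sum.cong simp: algebra_simps)
qed

text \<open>The reduced matrix is the distance matrix acting on the invariant subspace of
  swap-symmetric vectors, in the coordinates \<open>pairs2\<close>.\<close>

lemma is_eigenvalue_red_iff:
  "is_eigenvalue_on pairs2 (red_matrix src tgt lab y) c \<longleftrightarrow>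
   (\<exists>x. x \<noteq> 0 \<and> (\<forall>p. x $ prod.swap p = x $ p) \<and> Tm y *v x = c *\<^sub>R x)"
proof
  assume "is_eigenvalue_on pairs2 (red_matrix src tgt lab y) c"
  then obtain f where f: "\<exists>p\<in>pairs2. f p \<noteq> 0"
    "\<And>p. p \<in> pairs2 \<Longrightarrow> (\<Sum>q\<in>pairs2. red_matrix src tgt lab y p q * f q) = c * f p"
    unfolding is_eigenvalue_on_def by blast
  define X where "X p = f (min (fst p) (snd p), max (fst p) (snd p))" for p
  have X: "X (prod.swap q) = X q" for q by (simp add: X_def min.commute max.commute)
  have Xf: "X q = f q" if "q \<in> pairs2" for q using that by (auto simp: X_def pairs2_def min_def max_def)
  have row: "(\<Sum>q\<in>UNIV. dist_matrix src tgt lab y p q * X q) = c * X p" if "p \<in> pairs2" for p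
    using f(2)[OF that] that by (subst sum_red_matrix) (simp_all add: X Xf cong: sum.cong)
  have "(\<Sum>q\<in>UNIV. dist_matrix src tgt lab y p q * X q) = c * X p" for p
  proof (cases "p \<in> pairs2")
    \<comment> \<open>Rows outside \<open>pairs2\<close> are mirror images of rows inside, as
      \<open>dist_matrix\<close> is invariant under swapping both indices.\<close>
    case False
    then have "prod.swap p \<in> pairs2" by (auto simp: pairs2_def)
    have "(\<Sum>q\<in>UNIV. dist_matrix src tgt lab y p q * X q) =
        (\<Sum>q\<in>range prod.swap. dist_matrix src tgt lab y p q * X q)" by simp
    also have "\<dots> = (\<Sum>q\<in>UNIV. dist_matrix src tgt lab y p (prod.swap q) * X q)"
      by (subst sum.reindex) (auto simp: X)
    also have "\<dots> = (\<Sum>q\<in>UNIV. dist_matrix src tgt lab y (prod.swap p) q * X q)"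
      using dist_matrix_swap[of y "prod.swap p"] by simp
    also have "\<dots> = c * X p" using row[OF \<open>prod.swap p \<in> pairs2\<close>] by (simp add: X)
    finally show ?thesis .
  qed (use row in auto)
  then have "Tm y *v (\<chi> p. X p) = c *\<^sub>R (\<chi> p. X p)" by (simp add: vec_eq_iff Tm_mult)
  moreover have "(\<chi> p. X p) \<noteq> 0" 
  proof -
    obtain p where "p \<in> pairs2" "f p \<noteq> 0" using f(1) by blast
    then have "(\<chi> p. X p) $ p \<noteq> 0" by (simp add: Xf)
    then show ?thesis by (metis zero_index)
  qed
  ultimately show "\<exists>x. x \<noteq> 0 \<and> (\<forall>p. x $ prod.swap p = x $ p) \<and> Tm y *v x = c *\<^sub>R x"
    using X by (intro exI[of _ "\<chi> p. X p"]) auto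
next
  assume "\<exists>x. x \<noteq> 0 \<and> (\<forall>p. x $ prod.swap p = x $ p) \<and> Tm y *v x = c *\<^sub>R x"
  then obtain x where x: "x \<noteq> 0" "\<And>p. x $ prod.swap p = x $ p" "Tm y *v x = c *\<^sub>R x" by blast
  obtain p where "x $ p \<noteq> 0" using x(1) by (auto simp: vec_eq_iff)
  then have "\<exists>p\<in>pairs2. x $ p \<noteq> 0"
  proof (cases "p \<in> pairs2")
    case False
    then have "prod.swap p \<in> pairs2" by (auto simp: pairs2_def)
    then show ?thesis using x(2)[of p] \<open>x $ p \<noteq> 0\<close> by metis
  qed blast
  moreover have "(\<Sum>q\<in>pairs2. red_matrix src tgt lab y p q * x $ q) = c * x $ p" for p
    using x(3) sum_red_matrix[of "\<lambda>q. x $ q" y p] x(2) Tm_mult[of y x p] by simp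
  ultimately show "is_eigenvalue_on pairs2 (red_matrix src tgt lab y) c"
    unfolding is_eigenvalue_on_def by blast
qed

abbreviation Lam where "Lam \<equiv> Lambda src tgt lab"

text \<open>The growth rate bounds every eigenvalue from above, and a symmetric eigenvector shows
  that the bound is attained by the reduced matrix.\<close>

lemma Lam_eqI:
  assumes "0 \<le> y" "0 < L" "(\<lambda>n. ln (N n y) / real n) \<longlonglongrightarrow> ln L"
    and "x \<noteq> 0" "\<And>p. x $ prod.swap p = x $ p" "Tm y *v x = L *\<^sub>R x"
  shows "Lam y = L"
  unfolding Lambda_def is_eigenvalue_red_iff
proof (rule Max_eqI)
  show "finite {c. \<exists>x. x \<noteq> 0 \<and> (\<forall>p. x $ prod.swap p = x $ p) \<and> Tm y *v x = c *\<^sub>R x}"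
    by (rule finite_subset[OF _ finite_eigenvalues[of "Tm y"]]) auto
  show "L \<in> {c. \<exists>x. x \<noteq> 0 \<and> (\<forall>p. x $ prod.swap p = x $ p) \<and> Tm y *v x = c *\<^sub>R x}"
    using assms(4-6) by blast
  fix c assume "c \<in> {c. \<exists>x. x \<noteq> 0 \<and> (\<forall>p. x $ prod.swap p = x $ p) \<and> Tm y *v x = c *\<^sub>R x}"
  then obtain z where z: "z \<noteq> 0" "Tm y *v z = c *\<^sub>R z" by blast
  have "c \<le> exp (ln L)"
    using assms(3) growth_N_iff[OF assms(1)]
    by (intro eigenvalue_le_growth[OF nonneg_Tm[OF assms(1)] z(2,1)]) simp
  then show "c \<le> L" using assms(2) by simp
qed

text \<open>Swapping coordinates produces another Perron vector, and there is only one.\<close>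

lemma perron_vec_Tm_swap:
  assumes y: "0 < y"
  shows "perron_vec (Tm y) $ prod.swap p = perron_vec (Tm y) $ p"
proof -
  let ?x = "perron_vec (Tm y)"
  define z where "z = (\<chi> p. ?x $ prod.swap p)"
  have x: "is_perron (Tm y) ?x" by (rule is_perron_perron_vec[OF primitive_Tm[OF y]])
  have reindex: "(\<Sum>q\<in>UNIV. f (prod.swap q)) = (\<Sum>q\<in>UNIV. f q)" for f :: "'v \<times> 'v \<Rightarrow> real"
    using sum.reindex[of prod.swap UNIV f] by simp
  have "z \<in> std_simplex" using x reindex[of "\<lambda>q. ?x $ q"]
    by (simp add: is_perron_def std_simplex_def z_def)
  moreover have "Tm y *v z = perron_val (Tm y) *\<^sub>R z"
  proof -
    have "(Tm y *v z) $ p = (Tm y *v ?x) $ prod.swap p" for p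
      unfolding Tm_mult z_def
      using reindex[of "\<lambda>q. dist_matrix src tgt lab y (prod.swap p) q * ?x $ q"]
      by (simp add: dist_matrix_swap)
    then show ?thesis using perron_eigen[OF primitive_Tm[OF y]]
      by (simp add: vec_eq_iff z_def)
  qed
  ultimately have "is_perron (Tm y) z" by (rule is_perronI)
  then have "?x = z" by (rule perron_vec_eqI[OF primitive_Tm[OF y]])
  then show ?thesis by (metis vec_lambda_beta z_def)
qed

lemma growth_pos:
  assumes y: "0 < y"
  shows "(\<lambda>n. ln (N n y) / real n) \<longlonglongrightarrow> ln (perron_val (Tm y))"
  using row_total_growth[OF primitive_Tm[OF y]] growth_N_iff[of y] y by simp

lemma perron_val_Tm_pos: "0 < y \<Longrightarrow> 0 < perron_val (Tm y)"
  unfolding perron_val_def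
  by (intro is_perron_pos[OF primitive_Tm is_perron_perron_vec] primitive_Tm)

lemma perron_vec_Tm_nonzero: "0 < y \<Longrightarrow> perron_vec (Tm y) \<noteq> 0"
  using is_perron_perron_vec[OF primitive_Tm, of y] std_simplex_nonzero
  by (auto simp: is_perron_def)

lemma Lam_eq_perron_val:
  assumes y: "0 < y"
  shows "Lam y = perron_val (Tm y)"
  using y perron_vec_Tm_swap[OF y] perron_eigen[OF primitive_Tm[OF y]]
  by (intro Lam_eqI[where x = "perron_vec (Tm y)"])
     (auto simp: growth_pos perron_val_Tm_pos perron_vec_Tm_nonzero)

section \<open>The dominant eigenvalue at zero\<close>

lemma N_zero: "N n 0 = real (card (S n))"
proof -
  have "N n 0 = (\<Sum>p\<in>Q n. if fst p = snd p then 1 else 0)"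
    unfolding N_def pair_hamming_def
    by (intro sum.cong refl) (auto simp: power_0_left hamming_eq_0_iff length_S)
  also have "\<dots> = (\<Sum>w\<in>S n. \<Sum>w'\<in>S n. if w = w' then 1 else 0)"
    by (simp add: sum.cartesian_product case_prod_unfold)
  also have "\<dots> = real (card (S n))" by (simp add: finite_S)
  finally show ?thesis .
qed

lemma N_one: "N n 1 = (real (card (S n)))\<^sup>2"
  by (simp add: N_def card_cartesian_product power2_eq_square)

lemma N_mono: "0 \<le> y \<Longrightarrow> y \<le> z \<Longrightarrow> N n y \<le> N n z"
  unfolding N_def by (intro sum_mono power_mono) auto

lemma growth_zero: "(\<lambda>n. ln (N n 0) / real n) \<longlonglongrightarrow> ln (Lam 1) / 2"
proof -
  have "(\<lambda>n. ln (N n 1) / real n / 2) \<longlonglongrightarrow> ln (Lam 1) / 2"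
    unfolding Lam_eq_perron_val[of 1, simplified] by (intro tendsto_intros growth_pos) auto
  moreover have "ln (N n 1) / real n / 2 = ln (N n 0) / real n" for n
  proof -
    have "0 < card (S n)" using finite_S S_nonempty by (simp add: card_gt_0_iff)
    then show ?thesis by (simp add: N_one N_zero ln_realpow)
  qed
  ultimately show ?thesis by simp
qed

lemma growth_le:
  assumes "0 \<le> y" "y \<le> z" "(\<lambda>n. ln (N n y) / real n) \<longlonglongrightarrow> g" "(\<lambda>n. ln (N n z) / real n) \<longlonglongrightarrow> g'"
  shows "g \<le> g'"
proof (rule LIMSEQ_le[OF assms(3,4)], intro exI allI impI)
  fix n
  show "ln (N n y) / real n \<le> ln (N n z) / real n"
    using N_mono[OF assms(1,2), of n] one_le_N[OF assms(1), of n] by (simp add: divide_right_mono)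
qed

text \<open>Compactness gives a limit of Perron vectors along \<open>y = 1 / (r k + 1)\<close>, a
  symmetric eigenvector at 0. Its eigenvalue is at most the growth rate by
  \<open>eigenvalue_le_growth\<close>, and at least that by monotonicity of \<open>N\<close> in
  \<open>y\<close>. The subsequence is kept for continuity at 0.\<close>

lemma Lam_zero_limit:
  obtains r where "strict_mono r" "(\<lambda>k. Lam (inverse (real (Suc (r k))))) \<longlonglongrightarrow> exp (ln (Lam 1) / 2)"
    "Lam 0 = exp (ln (Lam 1) / 2)"
proof -
  define z where "z k = inverse (real (Suc k))" for k
  have z: "0 < z k" for k by (simp add: z_def)
  define x where "x k = perron_vec (Tm (z k))" for k
  have xper: "is_perron (Tm (z k)) (x k)" for k
    unfolding x_def by (intro is_perron_perron_vec primitive_Tm z)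
  then have "\<forall>k. x k \<in> std_simplex" by (simp add: is_perron_def)
  then obtain l r where lr: "l \<in> std_simplex" "strict_mono r" "(x \<circ> r) \<longlonglongrightarrow> l"
    using compact_std_simplex unfolding compact_eq_seq_compact_metric seq_compact_def by blast
  have z0: "(\<lambda>k. z (r k)) \<longlonglongrightarrow> 0"
    using LIMSEQ_subseq_LIMSEQ[OF LIMSEQ_inverse_real_of_nat lr(2)] by (simp add: z_def[abs_def] comp_def)
  have "isCont Tm 0" using continuous_on_Tm[of UNIV] by (simp add: continuous_on_eq_continuous_at)
  then have T0: "(\<lambda>k. Tm (z (r k))) \<longlonglongrightarrow> Tm 0" using z0 by (rule isCont_tendsto_compose)
  have l: "(\<lambda>k. x (r k)) \<longlonglongrightarrow> l" using lr(3) by (simp add: comp_def)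
  have Tl: "(\<lambda>k. Tm (z (r k)) *v x (r k)) \<longlonglongrightarrow> Tm 0 *v l"
    unfolding matrix_vector_mult_def
    by (intro tendsto_vec_lambda tendsto_intros tendsto_vec_nth T0 l)
  define L where "L = coord_sum (Tm 0 *v l)"
  have L: "(\<lambda>k. Lam (z (r k))) \<longlonglongrightarrow> L"
    unfolding L_def Lam_eq_perron_val[OF z] perron_val_def x_def[symmetric]
    by (intro tendsto_intros Tl)
  have "(\<lambda>k. Lam (z (r k)) *\<^sub>R x (r k)) \<longlonglongrightarrow> L *\<^sub>R l" by (intro tendsto_intros L l)
  moreover have "Lam (z (r k)) *\<^sub>R x (r k) = Tm (z (r k)) *v x (r k)" for k
    unfolding Lam_eq_perron_val[OF z] x_def by (simp add: perron_eigen[OF primitive_Tm[OF z]])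
  ultimately have eig: "Tm 0 *v l = L *\<^sub>R l" using Tl LIMSEQ_unique by simp
  have sym: "l $ prod.swap p = l $ p" for p
  proof (rule LIMSEQ_unique)
    show "(\<lambda>k. x (r k) $ p) \<longlonglongrightarrow> l $ p" by (intro tendsto_intros l)
    have "(\<lambda>k. x (r k) $ prod.swap p) \<longlonglongrightarrow> l $ prod.swap p" by (intro tendsto_intros l)
    then show "(\<lambda>k. x (r k) $ p) \<longlonglongrightarrow> l $ prod.swap p"
      unfolding x_def perron_vec_Tm_swap[OF z] .
  qed
  have "L \<le> exp (ln (Lam 1) / 2)"
    using growth_zero growth_N_iff[of 0]
    by (intro eigenvalue_le_growth[OF nonneg_Tm eig std_simplex_nonzero[OF lr(1)]]) auto
  moreover have "exp (ln (Lam 1) / 2) \<le> L"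
  proof (rule LIMSEQ_le_const[OF L], intro exI allI impI)
    fix k
    have "ln (Lam 1) / 2 \<le> ln (perron_val (Tm (z (r k))))"
      using z[of "r k"] by (intro growth_le[OF _ _ growth_zero growth_pos]) auto
    then have "exp (ln (Lam 1) / 2) \<le> exp (ln (perron_val (Tm (z (r k)))))" by simp
    then show "exp (ln (Lam 1) / 2) \<le> Lam (z (r k))"
      using perron_val_Tm_pos[OF z] by (simp add: Lam_eq_perron_val[OF z])
  qed
  ultimately have Leq: "L = exp (ln (Lam 1) / 2)" by simp
  have "Lam 0 = L"
    using growth_zero std_simplex_nonzero[OF lr(1)] eig sym
    by (intro Lam_eqI[where x = l]) (auto simp: Leq)
  then show ?thesis using that lr(2) L by (simp add: Leq z_def)
qed

lemma Lam_pos: "0 \<le> y \<Longrightarrow> 0 < Lam y"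
  using Lam_zero_limit Lam_eq_perron_val perron_val_Tm_pos
  by (metis exp_gt_zero order_le_less)

lemma ln_Lam_zero: "ln (Lam 0) = ln (Lam 1) / 2"
  using Lam_zero_limit by (metis ln_exp)

lemma growth: "0 \<le> y \<Longrightarrow> (\<lambda>n. ln (N n y) / real n) \<longlonglongrightarrow> ln (Lam y)"
  using growth_zero growth_pos by (cases "y = 0") (auto simp: ln_Lam_zero Lam_eq_perron_val)

lemma Lam_mono: "0 \<le> y \<Longrightarrow> y \<le> z \<Longrightarrow> Lam y \<le> Lam z"
  using growth_le[OF _ _ growth growth, of y z] by (simp add: Lam_pos)

text \<open>Monotonicity upgrades convergence along one sequence to a one-sided limit.\<close>

lemma Lam_tendsto_zero: "(Lam \<longlongrightarrow> Lam 0) (at_right 0)"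
proof (rule order_tendstoI)
  fix b assume "b < Lam 0"
  then show "\<forall>\<^sub>F y in at_right 0. b < Lam y"
    using Lam_mono by (auto simp: eventually_at_right_less intro!: eventually_mono[OF eventually_at_right_less] elim: less_le_trans)
next
  fix b assume b: "Lam 0 < b"
  obtain r where r: "(\<lambda>k. Lam (inverse (real (Suc (r k))))) \<longlonglongrightarrow> Lam 0"
    using Lam_zero_limit by metis
  then obtain k where k: "Lam (inverse (real (Suc (r k)))) < b"
    using order_tendstoD(2)[OF r b] by (auto simp: eventually_sequentially)
  have "\<forall>\<^sub>F y in at_right 0. y \<in> {0<..<inverse (real (Suc (r k)))}"
    by (rule eventually_at_right_real) simp
  then show "\<forall>\<^sub>F y in at_right 0. Lam y < b"
    by eventually_elim (auto intro!: le_less_trans[OF Lam_mono k])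
qed

section \<open>The Gilbert--Varshamov curve\<close>

abbreviation dl where "dl \<equiv> delta_y src tgt lab"
abbreviation Lam' where "Lam' \<equiv> Lambda' src tgt lab"

definition perron_slope :: "real \<Rightarrow> real" where
  "perron_slope y = perron_vec (transpose (Tm y)) \<bullet> ((Tm 1 - Tm 0) *v perron_vec (Tm y)) /
     (perron_vec (transpose (Tm y)) \<bullet> perron_vec (Tm y))"

lemma Lam_deriv:
  assumes y: "0 < y"
  shows "Lam' y = perron_slope y" "(Lam has_real_derivative Lam' y) (at y)"
proof -
  have "((\<lambda>z. perron_val (Tm z)) has_real_derivative perron_slope y) (at y)"
    using perron_val_has_derivative[of "{0<..}" y "Tm 0" "Tm 1 - Tm 0"] y primitive_Tm
    by (simp add: Tm_affine[symmetric] perron_slope_def)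
  then have D: "(Lam has_real_derivative perron_slope y) (at y)"
    by (rule has_field_derivative_transform_within_open[of _ _ _ "{0<..}"])
       (use y in \<open>auto simp: Lam_eq_perron_val\<close>)
  \<comment> \<open>At positive \<open>y\<close> the one-sided domain is a neighbourhood, so the
    choice in \<open>Lambda'\<close> is determined by the two-sided derivative.\<close>
  have within: "at y within {0..} = at y"
    using y by (intro at_within_interior interiorI[of "{0<..}"]) auto
  have "Lam' y = (SOME D. (Lam has_real_derivative D) (at y))"
    by (simp add: Lambda'_def within)
  also have "\<dots> = perron_slope y" using D by (intro some_equality) (auto intro: DERIV_unique)
  finally show "Lam' y = perron_slope y" .
  then show "(Lam has_real_derivative Lam' y) (at y)" using D by simp
qed

lemma continuous_on_dl_pos: "continuous_on {0<..} dl"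
proof -
  have "continuous_on {0<..} perron_slope"
    using continuous_on_perron_val_deriv[of "{0<..}" "Tm 0" "Tm 1 - Tm 0"] primitive_Tm
    by (simp add: Tm_affine[symmetric] perron_slope_def[abs_def])
  then have "continuous_on {0<..} Lam'"
    by (rule continuous_on_eq) (simp add: Lam_deriv)
  moreover have "continuous_on {0<..} Lam"
    by (auto intro!: continuous_at_imp_continuous_on DERIV_isCont Lam_deriv)
  ultimately show ?thesis
    unfolding delta_y_def[abs_def]
    by (intro continuous_intros) (auto simp: Lam_pos less_imp_neq[symmetric])
qed

lemma sum_exp_eq_N: "(\<Sum>p\<in>Q n. exp (t * real (pair_hamming p))) = N n (exp t)"
  by (simp add: N_def exp_of_nat2_mult)

sublocale ldp: partition_growth Q pair_hamming "\<lambda>t. ln (Lam (exp t))" "\<lambda>t. dl (exp t)"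
proof
  show "finite (Q n)" "Q n \<noteq> {}" for n using finite_S S_nonempty by auto
  show "(\<lambda>n. ln (\<Sum>p\<in>Q n. exp (t * real (pair_hamming p))) / real n) \<longlonglongrightarrow> ln (Lam (exp t))" for t
    unfolding sum_exp_eq_N by (rule growth) simp
  fix t :: real
  have "((\<lambda>t. Lam (exp t)) has_real_derivative Lam' (exp t) * exp t) (at t)"
    by (intro DERIV_chain2[OF Lam_deriv(2)] DERIV_exp) simp
  then have "((\<lambda>t. ln (Lam (exp t))) has_real_derivative
      inverse (Lam (exp t)) * (Lam' (exp t) * exp t)) (at t)"
    by (intro DERIV_chain2[OF DERIV_ln]) (auto simp: Lam_pos)
  then show "((\<lambda>t. ln (Lam (exp t))) has_real_derivative dl (exp t)) (at t)"
    by (simp add: delta_y_def field_simps)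
qed

section \<open>Range and continuity of the slope\<close>

lemma tangent:
  assumes "0 < y" "0 < z"
  shows "ln (Lam y) + (ln z - ln y) * dl y \<le> ln (Lam z)"
  using ldp.tangent_below[of "ln y" "ln z"] assms by simp

text \<open>The factor \<open>y\<close> decides the value, whatever \<open>Lambda'\<close> is at
  0.\<close>

lemma dl_zero: "dl 0 = 0"
  by (simp add: delta_y_def)

text \<open>The tangent at \<open>y\<close>, evaluated one unit of \<open>ln\<close> to the left,
  lies below \<open>ln (Lam y)\<close> because \<open>Lam\<close> is monotone.\<close>

lemma dl_nonneg:
  assumes "0 \<le> y"
  shows "0 \<le> dl y"
proof (cases "y = 0")
  case False
  then have y: "0 < y" using assms by simp
  have "ln (y * exp (- 1)) - ln y = - 1" using y by (simp add: ln_mult)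
  moreover have "Lam (y * exp (- 1)) \<le> Lam y" using y by (intro Lam_mono) auto
  then have "ln (Lam (y * exp (- 1))) \<le> ln (Lam y)" using y by (simp add: Lam_pos)
  ultimately show ?thesis using tangent[of y "y * exp (- 1)"] y by simp
qed (simp add: dl_zero)

lemma dl_le_increment:
  assumes "0 < y"
  shows "dl y \<le> ln (Lam (exp 1 * y)) - ln (Lam y)"
proof -
  have "ln (exp 1 * y) - ln y = 1" using assms by (simp add: ln_mult)
  then show ?thesis using tangent[of y "exp 1 * y"] assms by simp
qed

text \<open>Distances are at most \<open>n\<close>, so multiplying \<open>y\<close> by
  \<open>exp 1\<close> raises \<open>N n y\<close> by a factor of at most \<open>exp n\<close>. This
  keeps the parametrised curve over the unit interval.\<close>

lemma dl_le_one:
  assumes "0 \<le> y"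
  shows "dl y \<le> 1"
proof (cases "y = 0")
  case False
  then have y: "0 < y" using assms by simp
  have "ln (Lam (exp 1 * y)) \<le> 1 + ln (Lam y)"
  proof (rule LIMSEQ_le)
    show "(\<lambda>n. ln (N n (exp 1 * y)) / real n) \<longlonglongrightarrow> ln (Lam (exp 1 * y))"
      using y by (intro growth) simp
    show "(\<lambda>n. 1 + ln (N n y) / real n) \<longlonglongrightarrow> 1 + ln (Lam y)"
      using y by (intro tendsto_intros growth) simp
    show "\<exists>M. \<forall>n\<ge>M. ln (N n (exp 1 * y)) / real n \<le> 1 + ln (N n y) / real n"
    proof (intro exI allI impI)
      fix n :: nat assume n: "1 \<le> n"
      have "N n (exp 1 * y) \<le> (\<Sum>p\<in>Q n. exp 1 ^ n * y ^ pair_hamming p)"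
        unfolding N_def
      proof (rule sum_mono)
        fix p assume "p \<in> Q n"
        then have "pair_hamming p \<le> n" using hamming_le_length[of "fst p" "snd p"] length_S
          by (auto simp: pair_hamming_def)
        then have "exp 1 ^ pair_hamming p \<le> (exp 1 ^ n :: real)" by (intro power_increasing) auto
        then show "(exp 1 * y) ^ pair_hamming p \<le> exp 1 ^ n * y ^ pair_hamming p"
          using y by (simp add: power_mult_distrib)
      qed
      also have "\<dots> = exp (real n) * N n y"
        by (simp add: N_def sum_distrib_left exp_of_nat_mult[symmetric])
      finally have le: "N n (exp 1 * y) \<le> exp (real n) * N n y" .
      have "0 < N n y" "0 < N n (exp 1 * y)"
        using one_le_N[of y n] one_le_N[of "exp 1 * y" n] y by auto
      then have "ln (N n (exp 1 * y)) \<le> ln (exp (real n) * N n y)" using le by simp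
      then have "ln (N n (exp 1 * y)) \<le> real n + ln (N n y)"
        using \<open>0 < N n y\<close> by (simp add: ln_mult)
      then show "ln (N n (exp 1 * y)) / real n \<le> 1 + ln (N n y) / real n"
        using n by (simp add: field_simps)
    qed
  qed
  then show ?thesis using dl_le_increment[OF y] by simp
qed (simp add: dl_zero)

text \<open>The slope lies between 0 and an increment of \<open>ln Lam\<close> that vanishes by
  continuity at 0, so no derivative at 0 is involved.\<close>

lemma dl_tendsto_zero: "(dl \<longlongrightarrow> 0) (at_right 0)"
proof (rule tendsto_sandwich[of "\<lambda>_. 0" _ _ "\<lambda>y. ln (Lam (exp 1 * y)) - ln (Lam y)"])
  have ev: "\<forall>\<^sub>F y::real in at_right 0. 0 < y" by (rule eventually_at_right_less)
  show "\<forall>\<^sub>F y in at_right 0. 0 \<le> dl y" using ev by eventually_elim (simp add: dl_nonneg)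
  show "\<forall>\<^sub>F y in at_right 0. dl y \<le> ln (Lam (exp 1 * y)) - ln (Lam y)"
    using ev by eventually_elim (rule dl_le_increment)
  have "((\<lambda>y::real. exp 1 * y) \<longlongrightarrow> exp 1 * 0) (at_right 0)" by (intro tendsto_intros)
  then have "filterlim (\<lambda>y::real. exp 1 * y) (at_right 0) (at_right 0)"
    unfolding filterlim_at using ev by (auto elim!: eventually_mono)
  from filterlim_compose[OF Lam_tendsto_zero this]
  have "((\<lambda>y. ln (Lam (exp 1 * y)) - ln (Lam y)) \<longlongrightarrow> ln (Lam 0) - ln (Lam 0)) (at_right 0)"
    using Lam_pos[of 0] by (intro tendsto_intros Lam_tendsto_zero) auto
  then show "((\<lambda>y. ln (Lam (exp 1 * y)) - ln (Lam y)) \<longlongrightarrow> 0) (at_right 0)" by simp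
qed simp

lemma dl_attains:
  assumes "0 \<le> b" "b \<le> dl 1"
  obtains y where "0 \<le> y" "y \<le> 1" "dl y = b"
proof -
  have "continuous_on {0..1} dl"
    unfolding continuous_on_eq_continuous_within
  proof
    fix y :: real assume y: "y \<in> {0..1}"
    show "continuous (at y within {0..1}) dl"
    proof (cases "y = 0")
      case True
      then show ?thesis using dl_tendsto_zero
        by (simp add: continuous_within at_within_Icc_at_right dl_zero)
    next
      case False
      then have "isCont dl y" using y continuous_on_dl_pos
        by (simp add: continuous_on_eq_continuous_at open_greaterThan)
      then show ?thesis by (rule continuous_at_imp_continuous_at_within)
    qed
  qed
  then show ?thesis using IVT'[of dl 0 b 1] assms that by (auto simp: dl_zero)
qed

text \<open>A horizontal tangent at \<open>y\<close> bounds \<open>Lam\<close> from below by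
  \<open>Lam y\<close> down to 0. Handles slope zero at positive \<open>y\<close>, where
  \<open>cnt_growth\<close> does not apply.\<close>

lemma Lam_eq_if_dl_zero:
  assumes "0 \<le> y" "dl y = 0"
  shows "Lam y = Lam 0"
proof (cases "y = 0")
  case False
  then have y: "0 < y" using assms by simp
  have "Lam y \<le> Lam 0"
  proof (rule tendsto_lowerbound[OF Lam_tendsto_zero])
    show "\<forall>\<^sub>F z in at_right 0. Lam y \<le> Lam z"
      using eventually_at_right_less
    proof eventually_elim
      case (elim z)
      then show ?case using tangent[of y z] y assms(2) by (simp add: Lam_pos)
    qed
  qed simp
  then show ?thesis using Lam_mono[of 0 y] y by simp
qed simp

section \<open>Growth of \<open>T_total\<close> and assembly of the curve\<close>

lemma T_total_eq_cnt: "T_total src tgt lab n d = ldp.cnt n (d - 1)"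
proof -
  have "{p \<in> Q n. pair_hamming p \<le> d - 1} = Sigma (S n) (\<lambda>x. {y \<in> S n. hamming x y \<le> d - 1})"
    by (auto simp: pair_hamming_def)
  then show ?thesis
    unfolding T_total_def ball_vol_def ldp.cnt_def by (simp add: card_SigmaI finite_S)
qed

lemma cnt_zero: "ldp.cnt n 0 = card (S n)"
proof -
  have "{p \<in> Q n. pair_hamming p \<le> 0} = (\<lambda>w. (w, w)) ` S n"
    by (auto simp: pair_hamming_def hamming_eq_0_iff length_S)
  then show ?thesis by (simp add: ldp.cnt_def card_image inj_on_def)
qed

lemma card_S_pos: "0 < card (S n)"
  using finite_S S_nonempty by (simp add: card_gt_0_iff)

lemma T_growth:
  assumes y: "0 \<le> y" "y \<le> 1"
  shows "(\<lambda>n. ln (real (T_total src tgt lab n (nat \<lfloor>dl y * real n\<rfloor>))) / real n)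
    \<longlonglongrightarrow> ln (Lam y) - (if y = 0 then 0 else dl y * ln y)"
proof (cases "dl y = 0")
  case True
  \<comment> \<open>With slope zero the radius \<open>0 - 1\<close> is 0 in the naturals, so only
    equal pairs are counted, as in \<open>N n 0\<close>.\<close>
  then have "Lam y = Lam 0" using y by (intro Lam_eq_if_dl_zero)
  then show ?thesis using True growth[of 0] by (simp add: T_total_eq_cnt cnt_zero N_zero)
next
  case False
  then have y0: "0 < y" using y dl_zero by (cases "y = 0") auto
  have "(\<lambda>n. ln (real (ldp.cnt n (nat \<lfloor>dl (exp (ln y)) * real n\<rfloor> - 1))) / real n)
    \<longlonglongrightarrow> ln (Lam (exp (ln y))) - ln y * dl (exp (ln y))"
  proof (rule ldp.cnt_growth)
    show "ln y \<le> 0" using y y0 by simp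
    show "0 < dl (exp (ln y))" using False dl_nonneg[of y] y0 by simp
    show "0 < ldp.cnt n 0" for n by (simp add: cnt_zero card_S_pos)
    fix b assume b: "0 < b" "b < dl (exp (ln y))"
    \<comment> \<open>Monotone slopes put \<open>b\<close> below \<open>dl 1\<close>, where it is
      attained; \<open>b > 0\<close> excludes the point 0, so its logarithm can be taken.\<close>
    have "dl y \<le> dl 1" using ldp.slope_mono[of "ln y" 0] y y0 by simp
    then obtain z where z: "0 \<le> z" "dl z = b" using b y0 dl_attains[of b] by auto
    then have "0 < z" using b dl_zero by (cases "z = 0") auto
    then show "\<exists>s. dl (exp s) = b" using z by (intro exI[of _ "ln z"]) simp
  qed
  then show ?thesis using y0 by (simp add: T_total_eq_cnt mult.commute)
qed

lemma capacity_eq: "capacity src tgt lab = ln (Lam 0) / ln 2"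
  using limsup_log[OF growth[of 0]] by (simp add: capacity_def N_zero)

lemma R_GV_dl: "0 \<le> y \<Longrightarrow> y \<le> 1 \<Longrightarrow> R_GV src tgt lab (dl y) = rho_GV src tgt lab y"
  using limsup_log[OF T_growth[of y]]
  by (simp add: R_GV_def T_tilde_def rho_GV_def log_def diff_divide_distrib)

lemma delta_max_eq: "delta_max src tgt lab = dl 1"
  by (simp add: delta_max_def delta_y_def)

text \<open>The count is squeezed between the one at \<open>dl 1\<close> and the number of all
  pairs, both with rate \<open>ln (Lam 1)\<close>, which is twice the capacity in natural
  logarithms.\<close>

lemma R_GV_beyond:
  assumes "dl 1 \<le> \<delta>"
  shows "R_GV src tgt lab \<delta> = 0"
proof -
  let ?c = "\<lambda>\<delta> n. real (ldp.cnt n (nat \<lfloor>\<delta> * real n\<rfloor> - 1))"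
  have cpos: "0 < ?c \<delta> n" for \<delta> n
    using card_S_pos[of n] ldp.cnt_mono[of 0 "nat \<lfloor>\<delta> * real n\<rfloor> - 1" n] by (simp add: cnt_zero)
  have "(\<lambda>n. ln (?c \<delta> n) / real n) \<longlonglongrightarrow> ln (Lam 1)"
  proof (rule tendsto_sandwich)
    show "(\<lambda>n. ln (?c (dl 1) n) / real n) \<longlonglongrightarrow> ln (Lam 1)"
      using T_growth[of 1] by (simp add: T_total_eq_cnt)
    show "(\<lambda>n. ln (N n 1) / real n) \<longlonglongrightarrow> ln (Lam 1)" by (rule growth) simp
    show "\<forall>\<^sub>F n in sequentially. ln (?c (dl 1) n) / real n \<le> ln (?c \<delta> n) / real n"
    proof (intro always_eventually allI)
      fix n
      have "dl 1 * real n \<le> \<delta> * real n" using assms by (intro mult_right_mono) auto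
      then have "\<lfloor>dl 1 * real n\<rfloor> \<le> \<lfloor>\<delta> * real n\<rfloor>" by (rule floor_mono)
      then have "?c (dl 1) n \<le> ?c \<delta> n"
        by (intro of_nat_mono ldp.cnt_mono diff_le_mono nat_mono)
      then show "ln (?c (dl 1) n) / real n \<le> ln (?c \<delta> n) / real n"
        using cpos[of n "dl 1"] cpos[of n \<delta>] by (simp add: divide_right_mono)
    qed
    show "\<forall>\<^sub>F n in sequentially. ln (?c \<delta> n) / real n \<le> ln (N n 1) / real n"
    proof (intro always_eventually allI)
      fix n
      have "ldp.cnt n d \<le> card (Q n)" for d
        unfolding ldp.cnt_def using finite_S by (intro card_mono) auto
      then have "?c \<delta> n \<le> real (card (Q n))" by (rule of_nat_mono)
      also have "\<dots> = N n 1" by (simp add: N_def)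
      finally have "?c \<delta> n \<le> N n 1" .
      then show "ln (?c \<delta> n) / real n \<le> ln (N n 1) / real n"
        using cpos[of n \<delta>] one_le_N[of 1 n] by (simp add: divide_right_mono)
    qed
  qed
  from limsup_log[OF this] show ?thesis
    by (simp add: R_GV_def T_tilde_def T_total_eq_cnt capacity_eq ln_Lam_zero)
qed

text \<open>Below \<open>dl 1\<close> every abscissa is some \<open>dl y\<close> by the intermediate
  value property; from \<open>dl 1\<close> on the rate vanishes. For the converse, slopes lie in the
  unit interval.\<close>

lemma GV_curve_eq:
  "GV_curve src tgt lab = {(dl y, rho_GV src tgt lab y) | y. y \<in> {0..1}}
     \<union> {(\<delta>, 0) | \<delta>. delta_max src tgt lab \<le> \<delta> \<and> \<delta> \<le> 1}" (is "_ = ?P \<union> ?Z")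
proof
  show "GV_curve src tgt lab \<subseteq> ?P \<union> ?Z"
  proof
    fix x assume "x \<in> GV_curve src tgt lab"
    then obtain \<delta> where x: "x = (\<delta>, R_GV src tgt lab \<delta>)" and \<delta>: "0 \<le> \<delta>" "\<delta> \<le> 1"
      by (auto simp: GV_curve_def)
    show "x \<in> ?P \<union> ?Z"
    proof (cases "dl 1 \<le> \<delta>")
      case True
      then show ?thesis using x \<delta> R_GV_beyond by (simp add: delta_max_eq)
    next
      case False
      then obtain y where "0 \<le> y" "y \<le> 1" "dl y = \<delta>" using dl_attains[of \<delta>] \<delta> by auto
      then show ?thesis using x R_GV_dl by auto
    qed
  qed
  show "?P \<union> ?Z \<subseteq> GV_curve src tgt lab"
  proof
    fix x assume "x \<in> ?P \<union> ?Z"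
    then show "x \<in> GV_curve src tgt lab"
    proof
      assume "x \<in> ?P"
      then obtain y where "0 \<le> y" "y \<le> 1" "x = (dl y, rho_GV src tgt lab y)" by auto
      then show ?thesis unfolding GV_curve_def
        using R_GV_dl[of y] dl_nonneg[of y] dl_le_one[of y] by auto
    next
      assume "x \<in> ?Z"
      then obtain \<delta> where "dl 1 \<le> \<delta>" "\<delta> \<le> 1" "x = (\<delta>, 0)" by (auto simp: delta_max_eq)
      then show ?thesis unfolding GV_curve_def
        using R_GV_beyond[of \<delta>] dl_nonneg[of 1] by auto
    qed
  qed
qed

end

theorem theorem1:
  fixes src tgt :: "'e::finite \<Rightarrow> 'v::{finite,linorder}" and lab :: "'e \<Rightarrow> bool"
  assumes "deterministic src lab"
    and "primitive src tgt"
  shows "GV_curve src tgt lab =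
           {(delta_y src tgt lab y, rho_GV src tgt lab y) | y. y \<in> {0..1}}
           \<union> {(\<delta>, 0) | \<delta>. delta_max src tgt lab \<le> \<delta> \<and> \<delta> \<le> 1}"
  using presentation.GV_curve_eq[OF presentation.intro[OF assms]] .

end
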